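(* Assume the project (as defined in the context) is strongly thresholdable with optimal threshold map $z^*(\cdot)$, and let $z^{*,-1}(\mathsf X)=\{\lambda\in\mathbb R: z^*(\lambda)\in\mathsf X\}$. Then the project is indexable if and only if $z^*(\cdot)$ is (strictly) increasing and continuous on $z^{*,-1}(\mathsf X)$, in which case its Whittle index is also (strictly) increasing and continuous, being $\lambda^*(x)=z^{*,-1}(x)$ for $x\in\mathsf X$ (where $z^{*,-1}(\cdot)$ denotes the inverse of the restriction of $z^*$ to $z^{*,-1}(\mathsf X)$).
   Context: Project model. $\mathsf X=\{x\in\mathbb R:\ell\le x\le u\}$ with $-\infty\le\ell<u\le\infty$; all sets and functions are Borel measurable. A project has state $X_t\in\mathsf X$ and action $A_t\in\{0,1\}$ ($1$ = active, $0$ = passive) at times $t=0,1,\dots$. When $(X_t,A_t)=(x,a)$ it yields reward $r(x,a)$, consumes $c(x,a)$ units of a resource, and $X_{t+1}\sim\kappa^a(x,\cdot)$, with $\kappa^0,\kappa^1$ Markov transition kernels on $\mathsf X$. The discount factor is $\beta\in[0,1)$. Standing assumption: for each $a\in\{0,1\}$, $r(\cdot,a)$ and $c(\cdot,a)$ are continuous on $\mathsf X$, $0\le c(x,0)<c(x,1)$ for all $x$, and there are a function $w:\mathsf X\to[1,\infty)$ and constants $M>0$, $\beta\le\gamma<1$ with $\max\{|r(x,a)|,c(x,a)\}\le M w(x)$ and $\beta\int w(y)\,\kappa^a(x,dy)\le\gamma w(x)$ for all $x,a$. $\Pi$ is the class of nonanticipative (history-dependent, possibly randomized) policies. $F(x,\pi)=\mathsf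 E_x^\pi[\sum_{t\ge0}\beta^t r(X_t,A_t)]$, $G(x,\pi)=\mathsf E_x^\pi[\sum_{t\ge0}\beta^t c(X_t,A_t)]$ with $X_0=x$. For $\lambda\in\mathbb R$, $V_\lambda(x,\pi)=F(x,\pi)-\lambda G(x,\pi)$ and $V^*_\lambda(x)=\sup_{\pi\in\Pi}V_\lambda(x,\pi)$. Let $V_\lambda^{\langle a,*\rangle}(x)=r(x,a)-\lambda c(x,a)+\beta\int V_\lambda^*(y)\,\kappa^a(x,dy)$ and $\Delta_\lambda(x)=V_\lambda^{\langle1,*\rangle}(x)-V_\lambda^{\langle0,*\rangle}(x)$. The project is indexable with Whittle index $\lambda^*:\mathsf X\to\mathbb R$ if $\operatorname{sgn}\Delta_\lambda(x)=\operatorname{sgn}(\lambda^*(x)-\lambda)$ for all $x\in\mathsf X$, $\lambda\in\mathbb R$, where $\operatorname{sgn}\in\{-1,0,1\}$. It is strongly thresholdable with optimal threshold map $z^*:\mathbb R\to\overline{\mathbb R}=\mathbb R\cup\{-\infty,\infty\}$ if $\operatorname{sgn}\Delta_\lambda(x)=\operatorname{sgn}(x-z^*(\lambda))$ for all $x\in\mathsf X$, $\lambda\in\mathbb R$ (with $\operatorname{sgn}(\pm\infty)=\pm1$).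
   Formalization: The equivalence also requires that z* maps z^{*,-1}(X) onto X, so that the inverse exists on all of X; without this the "if" direction is false (e.g. z* identically −∞), and indexability is shown to imply it. *)

theory Defs
  imports "HOL-Probability.Probability"
begin

text \<open>
  A single restless bandit project with a real state. Actions are booleans, \<open>True\<close> being
  the active action and \<open>False\<close> the passive one.
\<close>

record project =
  lower :: ereal
  upper :: ereal
  disc :: real
  reward :: "real \<Rightarrow> bool \<Rightarrow> real"
  consumption :: "real \<Rightarrow> bool \<Rightarrow> real"
  kernel :: "bool \<Rightarrow> real \<Rightarrow> real measure"

definition states :: "project \<Rightarrow> real set" where
  "states P = {x. lower P \<le> ereal x \<and> ereal x \<le> upper P}"

definition state_space :: "project \<Rightarrow> real measure" where
  "state_space P = restrict_space borel (states P)"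

definition stage_space :: "project \<Rightarrow> (real \<times> bool) measure" where
  "stage_space P = state_space P \<Otimes>\<^sub>M count_space UNIV"

text \<open>
  The drift condition on the weight \<open>w\<close> uses the nonnegative integral, so that it entails
  integrability of \<open>w\<close> whenever the discount factor is positive (the Bochner integral of a
  non-integrable function is \<open>0\<close>). Measurability of rewards and consumptions follows from
  continuity.
\<close>

definition valid_project :: "project \<Rightarrow> bool" where
  "valid_project P \<longleftrightarrow>
     lower P < upper P \<and>
     0 \<le> disc P \<and> disc P < 1 \<and>
     (\<forall>a. kernel P a \<in> state_space P \<rightarrow>\<^sub>M prob_algebra (state_space P)) \<and>
     (\<forall>a. continuous_on (states P) (\<lambda>x. reward P x a)) \<and>
     (\<forall>a. continuous_on (states P) (\<lambda>x. consumption P x a)) \<and>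
     (\<forall>x\<in>states P. 0 \<le> consumption P x False \<and> consumption P x False < consumption P x True) \<and>
     (\<exists>w M \<gamma>. w \<in> borel_measurable (state_space P) \<and>
        (\<forall>x\<in>states P. 1 \<le> w x) \<and> 0 < M \<and> disc P \<le> \<gamma> \<and> \<gamma> < 1 \<and>
        (\<forall>x\<in>states P. \<forall>a. max \<bar>reward P x a\<bar> (consumption P x a) \<le> M * w x) \<and>
        (\<forall>x\<in>states P. \<forall>a.
           ennreal (disc P) * (\<integral>\<^sup>+y. ennreal (w y) \<partial>kernel P a x) \<le> ennreal (\<gamma> * w x)))"

text \<open>
  A policy gives, at each time \<open>n\<close>, the distribution of the action as a measurable function
  of the state-action pairs at times \<open>0, \<dots>, n - 1\<close> and the state at time \<open>n\<close>.
\<close>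

type_synonym policy = "nat \<Rightarrow> (nat \<Rightarrow> real \<times> bool) \<times> real \<Rightarrow> bool measure"

definition policies :: "project \<Rightarrow> policy set" where
  "policies P = {\<pi>. \<forall>n. \<pi> n \<in> PiM {0..<n} (\<lambda>_. stage_space P) \<Otimes>\<^sub>M state_space P
                        \<rightarrow>\<^sub>M prob_algebra (count_space UNIV)}"

text \<open>Conditional law of the state-action pair at time \<open>n\<close> given the previous pairs.\<close>

definition next_state :: "project \<Rightarrow> real \<Rightarrow> nat \<Rightarrow> (nat \<Rightarrow> real \<times> bool) \<Rightarrow> real measure" where
  "next_state P x n h =
     (if n = 0 then return (state_space P) x
      else kernel P (snd (h (n - 1))) (fst (h (n - 1))))"

definition stage_law ::
  "project \<Rightarrow> policy \<Rightarrow> real \<Rightarrow> nat \<Rightarrow> (nat \<Rightarrow> real \<times> bool) \<Rightarrow> (real \<times> bool) measure" where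
  "stage_law P \<pi> x n h =
     next_state P x n h \<bind> (\<lambda>y. \<pi> n (h, y) \<bind> (\<lambda>a. return (stage_space P) (y, a)))"

lemma stage_law_Ionescu_Tulcea:
  assumes "valid_project P" and "\<pi> \<in> policies P" and x: "x \<in> states P"
  shows "Ionescu_Tulcea (stage_law P \<pi> x) (\<lambda>_. stage_space P)"
proof -
  have [measurable]: "kernel P a \<in> state_space P \<rightarrow>\<^sub>M prob_algebra (state_space P)" for a
    using assms(1) by (simp add: valid_project_def)
  have pol: "\<pi> n \<in> PiM {0..<n} (\<lambda>_. stage_space P) \<Otimes>\<^sub>M state_space P
                        \<rightarrow>\<^sub>M prob_algebra (count_space UNIV)" for n
    using assms(2) by (simp add: policies_def)
  have xs: "x \<in> space (state_space P)"
    using x by (simp add: state_space_def space_restrict_space)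
  have k: "(\<lambda>z. kernel P (snd z) (fst z)) \<in> stage_space P \<rightarrow>\<^sub>M prob_algebra (state_space P)"
  proof -
    have "(\<lambda>z. if snd z then kernel P True (fst z) else kernel P False (fst z))
            \<in> stage_space P \<rightarrow>\<^sub>M prob_algebra (state_space P)"
      unfolding stage_space_def by measurable
    also have "(\<lambda>z::real \<times> bool. if snd z then kernel P True (fst z) else kernel P False (fst z))
                 = (\<lambda>z. kernel P (snd z) (fst z))"
      by auto
    finally show ?thesis .
  qed
  have nxt: "next_state P x n \<in> PiM {0..<n} (\<lambda>_. stage_space P) \<rightarrow>\<^sub>M prob_algebra (state_space P)"
    for n
  proof (cases "n = 0")
    case True
    have "return (state_space P) x \<in> space (prob_algebra (state_space P))"
      using xs by (simp add: space_prob_algebra prob_space_return)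
    then show ?thesis
      using True by (simp add: next_state_def[abs_def])
  next
    case False
    then have "(\<lambda>h. h (n - 1)) \<in> PiM {0..<n} (\<lambda>_. stage_space P) \<rightarrow>\<^sub>M stage_space P"
      by (intro measurable_component_singleton) auto
    from measurable_compose[OF this k] False show ?thesis
      by (simp add: next_state_def[abs_def])
  qed
  have act: "(\<lambda>p. \<pi> n p \<bind> (\<lambda>a. return (stage_space P) (snd p, a)))
      \<in> PiM {0..<n} (\<lambda>_. stage_space P) \<Otimes>\<^sub>M state_space P \<rightarrow>\<^sub>M prob_algebra (stage_space P)" for n
  proof (rule measurable_bind_prob_space2[where N = "count_space UNIV"])
    have "(\<lambda>q. (snd (fst q), snd q))
            \<in> (PiM {0..<n} (\<lambda>_. stage_space P) \<Otimes>\<^sub>M state_space P) \<Otimes>\<^sub>M count_space UNIV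
              \<rightarrow>\<^sub>M stage_space P"
      unfolding stage_space_def
      by (intro measurable_Pair measurable_compose[OF measurable_fst measurable_snd] measurable_snd)
    from measurable_compose[OF this measurable_return_prob_space]
    show "(\<lambda>(p, a). return (stage_space P) (snd p, a))
            \<in> (PiM {0..<n} (\<lambda>_. stage_space P) \<Otimes>\<^sub>M state_space P) \<Otimes>\<^sub>M count_space UNIV
              \<rightarrow>\<^sub>M prob_algebra (stage_space P)"
      by (simp add: split_beta')
  qed (rule pol)
  have law: "stage_law P \<pi> x n
      \<in> PiM {0..<n} (\<lambda>_. stage_space P) \<rightarrow>\<^sub>M prob_algebra (stage_space P)" for n
    unfolding stage_law_def[abs_def]
    by (rule measurable_bind_prob_space2[OF nxt])
       (use act[of n] in \<open>simp add: split_beta'\<close>)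
  show ?thesis
  proof (rule Ionescu_Tulcea.intro)
    show "stage_law P \<pi> x n \<in> PiM {0..<n} (\<lambda>_. stage_space P) \<rightarrow>\<^sub>M subprob_algebra (stage_space P)"
      for n
      by (rule measurable_prob_algebraD[OF law])
    show "prob_space (stage_law P \<pi> x n h)" if "h \<in> space (PiM {0..<n} (\<lambda>_. stage_space P))" for n h
      using measurable_space[OF law that] by (simp add: space_prob_algebra)
  qed
qed

text \<open>
  The law of the whole trajectory of state-action pairs from initial state \<open>x\<close>, that is,
  the Ionescu-Tulcea limit of the kernels above.
\<close>

definition trajectory ::
  "project \<Rightarrow> policy \<Rightarrow> real \<Rightarrow> (nat \<Rightarrow> real \<times> bool) measure" where
  "trajectory P \<pi> x =
     projective_family.lim UNIV (Ionescu_Tulcea.CI (stage_law P \<pi> x) (\<lambda>_. stage_space P))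
       (\<lambda>_. stage_space P)"

definition discounted_total ::
  "project \<Rightarrow> (real \<Rightarrow> bool \<Rightarrow> real) \<Rightarrow> real \<Rightarrow> policy \<Rightarrow> real" where
  "discounted_total P f x \<pi> =
     (\<integral>\<omega>. (\<Sum>t. disc P ^ t * f (fst (\<omega> t)) (snd (\<omega> t))) \<partial>trajectory P \<pi> x)"

definition reward_measure :: "project \<Rightarrow> real \<Rightarrow> policy \<Rightarrow> real" where
  "reward_measure P x \<pi> = discounted_total P (reward P) x \<pi>"

definition resource_measure :: "project \<Rightarrow> real \<Rightarrow> policy \<Rightarrow> real" where
  "resource_measure P x \<pi> = discounted_total P (consumption P) x \<pi>"

definition net_value :: "project \<Rightarrow> real \<Rightarrow> real \<Rightarrow> policy \<Rightarrow> real" where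
  "net_value P \<nu> x \<pi> = reward_measure P x \<pi> - \<nu> * resource_measure P x \<pi>"

definition optimal_value :: "project \<Rightarrow> real \<Rightarrow> real \<Rightarrow> real" where
  "optimal_value P \<nu> x = (SUP \<pi>\<in>policies P. net_value P \<nu> x \<pi>)"

definition action_value :: "project \<Rightarrow> real \<Rightarrow> bool \<Rightarrow> real \<Rightarrow> real" where
  "action_value P \<nu> a x =
     reward P x a - \<nu> * consumption P x a + disc P * (\<integral>y. optimal_value P \<nu> y \<partial>kernel P a x)"

definition marginal_value :: "project \<Rightarrow> real \<Rightarrow> real \<Rightarrow> real" where
  "marginal_value P \<nu> x = action_value P \<nu> True x - action_value P \<nu> False x"

definition is_whittle_index :: "project \<Rightarrow> (real \<Rightarrow> real) \<Rightarrow> bool" where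
  "is_whittle_index P \<iota> \<longleftrightarrow>
     (\<forall>x\<in>states P. \<forall>\<nu>. sgn (marginal_value P \<nu> x) = sgn (\<iota> x - \<nu>))"

definition indexable :: "project \<Rightarrow> bool" where
  "indexable P \<longleftrightarrow> (\<exists>\<iota>. is_whittle_index P \<iota>)"

definition strongly_thresholdable :: "project \<Rightarrow> (real \<Rightarrow> ereal) \<Rightarrow> bool" where
  "strongly_thresholdable P z \<longleftrightarrow>
     (\<forall>x\<in>states P. \<forall>\<nu>. ereal (sgn (marginal_value P \<nu> x)) = sgn (ereal x - z \<nu>))"

text \<open>
  The inverse of \<open>z\<close> restricted to \<open>state_prices P z\<close> is defined on all of \<open>states P\<close> only if
  the restriction is onto \<open>states P\<close>; strict monotonicity and continuity do not imply this.
\<close>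

definition state_prices :: "project \<Rightarrow> (real \<Rightarrow> ereal) \<Rightarrow> real set" where
  "state_prices P z = {\<nu>. z \<nu> \<in> ereal ` states P}"

end

theory Submission
  imports Defs
begin

text \<open>
  Given strong thresholdability, the price \<open>\<nu>\<close> is a zero of \<open>\<nu> \<mapsto> marginal_value P \<nu> x\<close> iff
  \<open>z \<nu> = x\<close>. An index and the threshold map then cut the set of pairs \<open>(\<nu>, x)\<close> along the same
  curve, which gives the monotonicity and continuity of both. Conversely, if \<open>z\<close> is strictly
  increasing and onto the states, the zero is unique, and it remains to exclude a wrong sign at
  prices whose threshold lies outside the state space. Since the marginal value is continuous in
  the price, its sign is constant on each side of the zero, and it is read off at the
  zero of a state above (or below) \<open>x\<close>. An endpoint of the state space is
  handled by comparison with states close to it.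

  Continuity in the price rests on the optimal value being a measurable function of the state,
  without which the Bochner integral in \<open>action_value\<close> would be the junk value \<open>0\<close>. It is the
  pointwise limit of the finite-horizon values produced by value iteration: telescoping along
  the trajectory shows that the horizon-\<open>N\<close> value bounds the first \<open>N\<close> expected rewards of every
  policy, with equality for the greedy policy, and the discounted tail is of order \<open>\<gamma> ^ N * w x\<close>.
\<close>

section \<open>Marginals of the Ionescu-Tulcea limit\<close>

context Ionescu_Tulcea
begin

text \<open>\<open>CI\<close> restricts the law of the first \<open>up_to J\<close> coordinates to
  \<open>J\<close>. For an initial segment \<open>up_to\<close> is its length, so the restriction
  forgets nothing.\<close>

lemma CI_atLeastLessThan: "CI {0..<n} = C 0 n (\<lambda>_. undefined)"
proof -
  have "up_to {0..<n} = n"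
  proof (rule antisym)
    show "n \<le> up_to {0..<n}"
      using up_to[of "{0..<n}"] by (cases n) auto
  qed (simp add: up_to_iff)
  then show ?thesis
    using distr_C[of n n "\<lambda>_. undefined" 0] by (simp add: CI_def)
qed

lemma nn_integral_lim_restrict:
  assumes g[measurable]: "g \<in> borel_measurable (PiM {0..<n} M)"
  shows "(\<integral>\<^sup>+\<omega>. g (restrict \<omega> {0..<n}) \<partial>PF.lim) = (\<integral>\<^sup>+\<omega>. g \<omega> \<partial>C 0 n (\<lambda>_. undefined))"
proof -
  have "(\<lambda>\<omega>. restrict \<omega> {0..<n}) \<in> PF.lim \<rightarrow>\<^sub>M PiM {0..<n} M"
    by (simp add: measurable_cong_sets[OF PF.sets_lim refl] measurable_restrict_subset)
  then have "(\<integral>\<^sup>+\<omega>. g (restrict \<omega> {0..<n}) \<partial>PF.lim)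
      = (\<integral>\<^sup>+\<omega>. g \<omega> \<partial>distr PF.lim (PiM {0..<n} M) (\<lambda>\<omega>. restrict \<omega> {0..<n}))"
    by (simp add: nn_integral_distr)
  then show ?thesis by (simp add: distr_lim CI_atLeastLessThan)
qed

text \<open>Tower property: \<open>C 0 (Suc n)\<close> is \<open>C 0 n\<close> followed by
  \<open>eP n\<close>, which appends a coordinate of law \<open>P n\<close>. Both sides are phrased
  over the limit so that inductions over time can stay on a single measure.\<close>

lemma nn_integral_lim_coordinate:
  assumes f[measurable]: "f \<in> borel_measurable (M n)"
  shows "(\<integral>\<^sup>+\<omega>. f (\<omega> n) \<partial>PF.lim) = (\<integral>\<^sup>+\<omega>. (\<integral>\<^sup>+y. f y \<partial>P n (restrict \<omega> {0..<n})) \<partial>PF.lim)"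
proof -
  have m: "(\<lambda>\<omega>. f (\<omega> n)) \<in> borel_measurable (PiM {0..<Suc n} M)" by measurable
  have m': "(\<lambda>\<omega>. \<integral>\<^sup>+y. f y \<partial>P n \<omega>) \<in> borel_measurable (PiM {0..<n} M)" by measurable
  have "(\<integral>\<^sup>+\<omega>. f (\<omega> n) \<partial>PF.lim) = (\<integral>\<^sup>+\<omega>. f (\<omega> n) \<partial>C 0 (Suc n) (\<lambda>_. undefined))"
    using nn_integral_lim_restrict[OF m] by simp
  also have "\<dots> = (\<integral>\<^sup>+\<omega>. \<integral>\<^sup>+\<omega>'. f (\<omega>' n) \<partial>eP n \<omega> \<partial>C 0 n (\<lambda>_. undefined))"
    using nn_integral_bind[OF m, of "eP n" "C 0 n (\<lambda>_. undefined)"]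
    by (simp add: measurable_cong_sets[OF sets_C refl])
  also have "\<dots> = (\<integral>\<^sup>+\<omega>. \<integral>\<^sup>+y. f y \<partial>P n \<omega> \<partial>C 0 n (\<lambda>_. undefined))"
    using nn_integral_eP[OF _ m] by (intro nn_integral_cong) (simp add: space_C)
  also have "\<dots> = (\<integral>\<^sup>+\<omega>. (\<integral>\<^sup>+y. f y \<partial>P n (restrict \<omega> {0..<n})) \<partial>PF.lim)"
    using nn_integral_lim_restrict[OF m'] by simp
  finally show ?thesis .
qed

lemma prob_space_lim: "prob_space PF.lim"
proof
  have "emeasure PF.lim (space PF.lim) = (\<integral>\<^sup>+\<omega>. 1 \<partial>PF.lim)" by simp
  \<comment> \<open>The marginal on no coordinates at all already carries the total mass.\<close>
  also have "\<dots> = (\<integral>\<^sup>+\<omega>. 1 \<partial>C 0 0 (\<lambda>_. undefined))"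
    using nn_integral_lim_restrict[of "\<lambda>_. 1" 0] by simp
  also have "\<dots> = 1"
    using prob_space.emeasure_space_1[OF prob_space_C[of "\<lambda>_. undefined" 0 0]]
    by (simp del: C.simps)
  finally show "emeasure PF.lim (space PF.lim) = 1" .
qed

end

section \<open>Value iteration in the weighted norm\<close>

text \<open>The weight, bound and rate that \<open>valid_project\<close> only asserts to exist are
  fixed, so that estimates can name them.\<close>

locale weighted_project =
  fixes P :: project and w :: "real \<Rightarrow> real" and M \<gamma> :: real
  assumes valid: "valid_project P"
    and w_measurable[measurable]: "w \<in> borel_measurable (state_space P)"
    and w_ge_1: "\<And>x. x \<in> states P \<Longrightarrow> 1 \<le> w x"
    and \<gamma>: "disc P \<le> \<gamma>" "\<gamma> < 1"
    and stage_bound: "\<And>x a. x \<in> states P \<Longrightarrow> max \<bar>reward P x a\<bar> (consumption P x a) \<le> M * w x"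
    and drift: "\<And>x a. x \<in> states P \<Longrightarrow>
      ennreal (disc P) * (\<integral>\<^sup>+y. ennreal (w y) \<partial>kernel P a x) \<le> ennreal (\<gamma> * w x)"
begin

abbreviation "\<beta> \<equiv> disc P"

lemma \<beta>: "0 \<le> \<beta>" "\<beta> < 1" and \<gamma>_nonneg: "0 \<le> \<gamma>"
  using valid \<gamma> by (auto simp: valid_project_def)

lemma w_nonneg: "x \<in> states P \<Longrightarrow> 0 \<le> w x"
  using w_ge_1 by fastforce

lemma space_state_space[simp]: "space (state_space P) = states P"
  by (simp add: state_space_def space_restrict_space)

lemma space_stage_space[simp]: "space (stage_space P) = states P \<times> UNIV"
  by (simp add: stage_space_def space_pair_measure)

lemma kernel_measurable[measurable]: "kernel P a \<in> state_space P \<rightarrow>\<^sub>M prob_algebra (state_space P)"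
  using valid by (simp add: valid_project_def)

lemma kernel:
  assumes "x \<in> states P"
  shows prob_space_kernel: "prob_space (kernel P a x)"
    and sets_kernel: "sets (kernel P a x) = sets (state_space P)"
    and space_kernel: "space (kernel P a x) = states P"
proof -
  have "kernel P a x \<in> space (prob_algebra (state_space P))"
    using assms measurable_space[OF kernel_measurable] by simp
  then show "prob_space (kernel P a x)" "sets (kernel P a x) = sets (state_space P)"
    by (auto simp: space_prob_algebra)
  then show "space (kernel P a x) = states P"
    using sets_eq_imp_space_eq[of "kernel P a x" "state_space P"] by simp
qed

text \<open>The actions form a two-point discrete space, so a function of state and action is
  patched together from its two sections.\<close>

lemma measurable_stage:
  assumes "\<And>a. (\<lambda>x. g x a) \<in> state_space P \<rightarrow>\<^sub>M N"
  shows "(\<lambda>p. g (fst p) (snd p)) \<in> stage_space P \<rightarrow>\<^sub>M N"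
proof -
  have [measurable]: "(\<lambda>x. g x a) \<in> state_space P \<rightarrow>\<^sub>M N" for a by (rule assms)
  have "(\<lambda>p. if snd p then g (fst p) True else g (fst p) False) \<in> stage_space P \<rightarrow>\<^sub>M N"
    unfolding stage_space_def by measurable
  also have "(\<lambda>p. if snd p then g (fst p) True else g (fst p) False) = (\<lambda>p. g (fst p) (snd p))"
    by auto
  finally show ?thesis .
qed

lemma kernel_stage_measurable[measurable]:
  "(\<lambda>p. kernel P (snd p) (fst p)) \<in> stage_space P \<rightarrow>\<^sub>M subprob_algebra (state_space P)"
  by (intro measurable_stage[of "\<lambda>x a. kernel P a x"] measurable_prob_algebraD kernel_measurable)

lemma kernel_integral_measurable[measurable]:
  fixes f :: "real \<Rightarrow> real"
  assumes "f \<in> borel_measurable (state_space P)"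
  shows "(\<lambda>x. \<integral>y. f y \<partial>kernel P a x) \<in> borel_measurable (state_space P)"
  using measurable_compose[OF measurable_prob_algebraD[OF kernel_measurable]
      integral_measurable_subprob_algebra[OF assms]] .

section \<open>The weighted supremum norm and one discounted kernel step\<close>

text \<open>The ball of radius \<open>K\<close> in the weighted supremum norm, among measurable
  functions.\<close>

definition weight_bounded :: "real \<Rightarrow> (real \<Rightarrow> real) \<Rightarrow> bool" where
  "weight_bounded K f \<longleftrightarrow>
     f \<in> borel_measurable (state_space P) \<and> (\<forall>x\<in>states P. \<bar>f x\<bar> \<le> K * w x)"

lemma weight_bounded_measurable: "weight_bounded K f \<Longrightarrow> f \<in> borel_measurable (state_space P)"
  and weight_boundedD: "weight_bounded K f \<Longrightarrow> x \<in> states P \<Longrightarrow> \<bar>f x\<bar> \<le> K * w x"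
  by (auto simp: weight_bounded_def)

lemma weight_bounded_weight: "weight_bounded 1 w"
  using w_nonneg by (auto simp: weight_bounded_def)

lemma weight_bounded_add:
  "weight_bounded K f \<Longrightarrow> weight_bounded L g \<Longrightarrow> weight_bounded (K + L) (\<lambda>x. f x + g x)"
  unfolding weight_bounded_def by (force simp: distrib_right)

lemma weight_bounded_cmult:
  "weight_bounded K f \<Longrightarrow> weight_bounded (\<bar>c\<bar> * K) (\<lambda>x. c * f x)"
  unfolding weight_bounded_def by (auto simp: abs_mult mult.assoc intro!: mult_left_mono)

definition stage_bounded :: "real \<Rightarrow> (real \<Rightarrow> bool \<Rightarrow> real) \<Rightarrow> bool" where
  "stage_bounded K g \<longleftrightarrow> (\<forall>a. weight_bounded K (\<lambda>y. g y a))"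

lemma states_nonempty: "states P \<noteq> {}"
proof -
  obtain r where "lower P < ereal r" "ereal r < upper P"
    using valid ereal_dense2[of "lower P" "upper P"] by (auto simp: valid_project_def)
  then have "r \<in> states P" by (simp add: states_def less_imp_le)
  then show ?thesis by auto
qed

lemma weight_bounded_nonneg: assumes "weight_bounded K f" shows "0 \<le> K"
proof -
  obtain x where "x \<in> states P" using states_nonempty by auto
  with weight_boundedD[OF assms this] w_ge_1[OF this] have "0 \<le> K * w x" "0 < w x" by auto
  then show ?thesis by (simp add: zero_le_mult_iff)
qed

text \<open>Dividing \<open>drift\<close> by a positive discount factor gives \<open>w\<close> a
  finite integral, and a multiple of \<open>w\<close> dominates \<open>f\<close>.\<close>

lemma weight_bounded_kernel_integrable:
  assumes f: "weight_bounded K f" and x: "x \<in> states P" and "0 < \<beta>"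
  shows "integrable (kernel P a x) f"
proof (rule Bochner_Integration.integrable_bound[where f="\<lambda>x. K * w x"])
  have "ennreal \<beta> * (\<integral>\<^sup>+y. ennreal (w y) \<partial>kernel P a x) < \<infinity>"
    using drift[OF x, of a] by (auto intro: le_less_trans)
  then have "(\<integral>\<^sup>+y. ennreal (w y) \<partial>kernel P a x) < \<infinity>"
    using \<open>0 < \<beta>\<close> by (auto simp: ennreal_mult_less_top)
  moreover have "w \<in> borel_measurable (kernel P a x)"
    by (simp add: measurable_cong_sets[OF sets_kernel[OF x] refl])
  ultimately have "integrable (kernel P a x) w"
    by (intro integrableI_nonneg) (auto simp: space_kernel[OF x] w_nonneg)
  then show "integrable (kernel P a x) (\<lambda>x. K * w x)" by simp
  show "f \<in> borel_measurable (kernel P a x)"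
    using weight_bounded_measurable[OF f] by (simp add: measurable_cong_sets[OF sets_kernel[OF x] refl])
  show "AE x in kernel P a x. norm (f x) \<le> norm (K * w x)"
    using weight_boundedD[OF f] by (force simp: space_kernel[OF x])
qed

lemma kernel_weight_le: assumes "x \<in> states P" shows "\<beta> * (\<integral>y. w y \<partial>kernel P a x) \<le> \<gamma> * w x"
proof (cases "\<beta> = 0")
  case True then show ?thesis using w_nonneg[OF assms] \<gamma>_nonneg by simp
next
  case False
  then have "0 < \<beta>" using \<beta> by simp
  have "(\<integral>\<^sup>+y. ennreal (w y) \<partial>kernel P a x) = ennreal (\<integral>y. w y \<partial>kernel P a x)"
    using weight_bounded_kernel_integrable[OF weight_bounded_weight assms \<open>0 < \<beta>\<close>]
    by (intro nn_integral_eq_integral) (auto simp: space_kernel[OF assms] w_nonneg)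
  with drift[OF assms, of a] show ?thesis
    using \<beta> \<gamma>_nonneg w_nonneg[OF assms] by (simp add: ennreal_mult'[symmetric])
qed

text \<open>
  Statements about the kernels carry the factor \<open>\<beta>\<close>, because for \<open>\<beta> = 0\<close> the drift condition does
  not make \<open>w\<close> integrable.
\<close>

lemma discounted_kernel_diff_le:
  assumes f: "weight_bounded K f" and g: "weight_bounded L g" and x: "x \<in> states P"
    and d: "\<And>y. y \<in> states P \<Longrightarrow> \<bar>f y - g y\<bar> \<le> C * w y" and "0 \<le> C"
  shows "\<bar>\<beta> * (\<integral>y. f y \<partial>kernel P a x) - \<beta> * (\<integral>y. g y \<partial>kernel P a x)\<bar> \<le> C * \<gamma> * w x"
proof (cases "\<beta> = 0")
  case True then show ?thesis using w_nonneg[OF x] \<gamma>_nonneg \<open>0 \<le> C\<close> by simp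
next
  case False
  then have b: "0 < \<beta>" using \<beta> by simp
  note i = weight_bounded_kernel_integrable[OF _ x b]
  have "\<bar>(\<integral>y. f y \<partial>kernel P a x) - (\<integral>y. g y \<partial>kernel P a x)\<bar> = \<bar>\<integral>y. f y - g y \<partial>kernel P a x\<bar>"
    using i[OF f] i[OF g] by simp
  also have "\<dots> \<le> (\<integral>y. \<bar>f y - g y\<bar> \<partial>kernel P a x)"
    by (rule integral_abs_bound)
  also have "\<dots> \<le> (\<integral>y. C * w y \<partial>kernel P a x)"
    using i[OF f] i[OF g] i[OF weight_bounded_weight] d
    by (intro integral_mono) (auto simp: space_kernel[OF x])
  also have "\<dots> = C * (\<integral>y. w y \<partial>kernel P a x)" by simp
  finally have "\<beta> * \<bar>(\<integral>y. f y \<partial>kernel P a x) - (\<integral>y. g y \<partial>kernel P a x)\<bar>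
      \<le> \<beta> * (C * (\<integral>y. w y \<partial>kernel P a x))"
    using b by simp
  also have "\<dots> \<le> C * (\<gamma> * w x)"
    using mult_left_mono[OF kernel_weight_le[OF x, of a] \<open>0 \<le> C\<close>] by (simp add: mult_ac)
  finally show ?thesis using b by (simp add: abs_mult right_diff_distrib[symmetric])
qed

text \<open>This is the difference estimate against the zero function: a discounted kernel step
  shrinks the radius by the factor \<open>\<gamma>\<close>.\<close>

lemma weight_bounded_discounted_kernel:
  assumes f: "weight_bounded K f"
  shows "weight_bounded (K * \<gamma>) (\<lambda>x. \<beta> * (\<integral>y. f y \<partial>kernel P a x))"
proof -
  have "weight_bounded 0 (\<lambda>_. 0)" by (simp add: weight_bounded_def)
  from discounted_kernel_diff_le[OF f this] weight_boundedD[OF f] weight_bounded_nonneg[OF f]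
  have "\<bar>\<beta> * (\<integral>y. f y \<partial>kernel P a x)\<bar> \<le> K * \<gamma> * w x" if "x \<in> states P" for x
    using that by (simp add: abs_mult)
  moreover note [measurable] = weight_bounded_measurable[OF f]
  ultimately show ?thesis by (auto simp: weight_bounded_def)
qed

section \<open>Net rewards and value iteration\<close>

definition net_reward :: "real \<Rightarrow> real \<Rightarrow> bool \<Rightarrow> real" where
  "net_reward \<nu> x a = reward P x a - \<nu> * consumption P x a"

lemma weight_bounded_reward: "weight_bounded M (\<lambda>x. reward P x a)"
  and weight_bounded_consumption: "weight_bounded M (\<lambda>x. consumption P x a)"
proof -
  \<comment> \<open>\<open>stage_bound\<close> bounds consumption from above only, so its sign is
    needed for the absolute value.\<close>
  have c: "0 \<le> consumption P x a" if "x \<in> states P" for x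
    using valid that by (cases a) (force simp: valid_project_def)+
  have "(\<lambda>x. reward P x a) \<in> borel_measurable (state_space P)"
    "(\<lambda>x. consumption P x a) \<in> borel_measurable (state_space P)"
    using valid unfolding state_space_def valid_project_def
    by (auto intro: borel_measurable_continuous_on_restrict)
  then show "weight_bounded M (\<lambda>x. reward P x a)" "weight_bounded M (\<lambda>x. consumption P x a)"
    using stage_bound[of _ a] c by (auto simp: weight_bounded_def)
qed

lemma M_nonneg: "0 \<le> M"
  using weight_bounded_nonneg weight_bounded_reward .

lemma weight_bounded_net_reward: "weight_bounded ((1 + \<bar>\<nu>\<bar>) * M) (\<lambda>x. net_reward \<nu> x a)"
  using weight_bounded_add[OF weight_bounded_reward[of a]
      weight_bounded_cmult[OF weight_bounded_consumption[of a], of "- \<nu>"]]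
  by (simp add: net_reward_def algebra_simps)

text \<open>One-step lookahead with \<open>f\<close> as the value of the remaining problem; with the
  optimal value as \<open>f\<close> it is \<open>action_value\<close>.\<close>

definition stage_value :: "real \<Rightarrow> (real \<Rightarrow> real) \<Rightarrow> bool \<Rightarrow> real \<Rightarrow> real" where
  "stage_value \<nu> f a x = net_reward \<nu> x a + \<beta> * (\<integral>y. f y \<partial>kernel P a x)"

primrec horizon_value :: "real \<Rightarrow> nat \<Rightarrow> real \<Rightarrow> real" where
  "horizon_value \<nu> 0 x = 0"
| "horizon_value \<nu> (Suc n) x =
     max (stage_value \<nu> (horizon_value \<nu> n) True x) (stage_value \<nu> (horizon_value \<nu> n) False x)"

lemma weight_bounded_stage_value:
  "weight_bounded K f \<Longrightarrow> weight_bounded ((1 + \<bar>\<nu>\<bar>) * M + K * \<gamma>) (stage_value \<nu> f a)"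
  unfolding stage_value_def[abs_def]
  by (intro weight_bounded_add weight_bounded_net_reward weight_bounded_discounted_kernel)

lemma weight_bounded_max:
  "weight_bounded K f \<Longrightarrow> weight_bounded K g \<Longrightarrow> weight_bounded K (\<lambda>x. max (f x) (g x))"
  unfolding weight_bounded_def by (auto simp: max_def)

text \<open>Some radius suffices, for measurability and integrability; the rate of convergence comes
  from the tail of the discounted series.\<close>

lemma weight_bounded_horizon_value: "\<exists>K. weight_bounded K (horizon_value \<nu> n)"
proof (induction n)
  case 0
  have "weight_bounded 0 (\<lambda>x. horizon_value \<nu> 0 x)" by (simp add: weight_bounded_def)
  then show ?case ..
next
  case (Suc n)
  then obtain K where "weight_bounded K (horizon_value \<nu> n)" ..
  from weight_bounded_max[OF this[THEN weight_bounded_stage_value] this[THEN weight_bounded_stage_value]]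
  show ?case by auto
qed

end

section \<open>Discounted expectations along a trajectory\<close>

locale controlled_project = weighted_project +
  fixes \<pi> :: policy and x :: real
  assumes policy: "\<pi> \<in> policies P" and x: "x \<in> states P"
begin

sublocale Ionescu_Tulcea "stage_law P \<pi> x" "\<lambda>_. stage_space P"
  by (rule stage_law_Ionescu_Tulcea[OF valid policy x])

abbreviation "T \<equiv> trajectory P \<pi> x"

lemma trajectory_eq_lim: "T = PF.lim"
  by (simp add: trajectory_def)

sublocale T: prob_space T
  unfolding trajectory_eq_lim by (rule prob_space_lim)

lemma sets_trajectory: "sets T = sets (PiM UNIV (\<lambda>_. stage_space P))"
  unfolding trajectory_eq_lim by simp

lemma coordinate_measurable[measurable]: "(\<lambda>\<omega>. \<omega> n) \<in> T \<rightarrow>\<^sub>M stage_space P"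
  by (simp add: measurable_cong_sets[OF sets_trajectory refl] measurable_component_singleton)

lemma state_measurable[measurable]: "(\<lambda>\<omega>. fst (\<omega> n)) \<in> T \<rightarrow>\<^sub>M state_space P"
  using measurable_compose[OF coordinate_measurable[unfolded stage_space_def] measurable_fst] .

lemma space_trajectory: "\<omega> \<in> space T \<Longrightarrow> fst (\<omega> n) \<in> states P"
  using measurable_space[OF state_measurable] by simp

lemma restrict_trajectory:
  "\<omega> \<in> space T \<Longrightarrow> restrict \<omega> {0..<n} \<in> space (PiM {0..<n} (\<lambda>_. stage_space P))"
  using sets_eq_imp_space_eq[OF sets_trajectory] by (auto simp: space_PiM)

section \<open>Conditional laws of states and actions\<close>

text \<open>\<open>stage_law\<close> draws the state first and the action given the state, so the
  integral iterates in this order.\<close>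

lemma nn_integral_stage_law:
  assumes h: "h \<in> space (PiM {0..<n} (\<lambda>_. stage_space P))"
    and nxt: "next_state P x n h \<in> space (prob_algebra (state_space P))"
    and f[measurable]: "f \<in> borel_measurable (stage_space P)"
  shows "(\<integral>\<^sup>+p. f p \<partial>stage_law P \<pi> x n h)
    = (\<integral>\<^sup>+y. (\<integral>\<^sup>+a. f (y, a) \<partial>\<pi> n (h, y)) \<partial>next_state P x n h)"
proof -
  have pol: "\<pi> n \<in> PiM {0..<n} (\<lambda>_. stage_space P) \<Otimes>\<^sub>M state_space P
      \<rightarrow>\<^sub>M prob_algebra (count_space UNIV)"
    using policy by (simp add: policies_def)
  have pol_h[measurable]: "(\<lambda>y. \<pi> n (h, y)) \<in> state_space P \<rightarrow>\<^sub>M prob_algebra (count_space UNIV)"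
    using measurable_compose[OF measurable_Pair1'[OF h] pol] .
  have ret: "(\<lambda>(y, a). return (stage_space P) (y, a))
      \<in> state_space P \<Otimes>\<^sub>M count_space UNIV \<rightarrow>\<^sub>M prob_algebra (stage_space P)"
    unfolding stage_space_def by simp
  have act: "(\<lambda>y. \<pi> n (h, y) \<bind> (\<lambda>a. return (stage_space P) (y, a)))
      \<in> state_space P \<rightarrow>\<^sub>M prob_algebra (stage_space P)"
    by (rule measurable_bind_prob_space2[OF pol_h ret])
  have sets_next: "sets (next_state P x n h) = sets (state_space P)"
    using nxt by (simp add: space_prob_algebra)
  have sp: "space (next_state P x n h) = states P"
    using sets_eq_imp_space_eq[OF sets_next] by simp
  have "(\<integral>\<^sup>+p. f p \<partial>stage_law P \<pi> x n h)
    = (\<integral>\<^sup>+y. (\<integral>\<^sup>+p. f p \<partial>(\<pi> n (h, y) \<bind> (\<lambda>a. return (stage_space P) (y, a)))) \<partial>next_state P x n h)"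
    unfolding stage_law_def
    by (rule nn_integral_bind[OF f])
       (simp add: measurable_cong_sets[OF sets_next refl] measurable_prob_algebraD[OF act])
  also have "\<dots> = (\<integral>\<^sup>+y. (\<integral>\<^sup>+a. f (y, a) \<partial>\<pi> n (h, y)) \<partial>next_state P x n h)"
  proof (rule nn_integral_cong)
    fix y assume "y \<in> space (next_state P x n h)"
    then have y: "y \<in> states P" by (simp add: sp)
    have sets_a: "sets (\<pi> n (h, y)) = sets (count_space UNIV)"
      using measurable_space[OF pol_h] y by (auto simp: space_prob_algebra)
    have "(\<lambda>a. return (stage_space P) (y, a)) \<in> count_space UNIV \<rightarrow>\<^sub>M subprob_algebra (stage_space P)"
      using y by (auto simp: space_subprob_algebra intro!: prob_space_imp_subprob_space prob_space_return)
    then have "(\<integral>\<^sup>+p. f p \<partial>(\<pi> n (h, y) \<bind> (\<lambda>a. return (stage_space P) (y, a))))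
      = (\<integral>\<^sup>+a. (\<integral>\<^sup>+p. f p \<partial>return (stage_space P) (y, a)) \<partial>\<pi> n (h, y))"
      by (intro nn_integral_bind[OF f]) (simp add: measurable_cong_sets[OF sets_a refl])
    also have "\<dots> = (\<integral>\<^sup>+a. f (y, a) \<partial>\<pi> n (h, y))"
      using y by (simp add: nn_integral_return)
    finally show "(\<integral>\<^sup>+p. f p \<partial>(\<pi> n (h, y) \<bind> (\<lambda>a. return (stage_space P) (y, a))))
      = (\<integral>\<^sup>+a. f (y, a) \<partial>\<pi> n (h, y))" .
  qed
  finally show ?thesis .
qed

lemma next_state_in_prob_algebra:
  assumes "\<omega> \<in> space T"
  shows "next_state P x n (restrict \<omega> {0..<n}) \<in> space (prob_algebra (state_space P))"
proof (cases n)
  case 0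
  then show ?thesis using x by (simp add: next_state_def space_prob_algebra prob_space_return)
next
  case (Suc m)
  then show ?thesis
    using space_trajectory[OF assms, of m]
    by (simp add: next_state_def space_prob_algebra prob_space_kernel sets_kernel)
qed

lemma nn_integral_coordinate:
  assumes f[measurable]: "f \<in> borel_measurable (stage_space P)"
  shows "(\<integral>\<^sup>+\<omega>. f (\<omega> n) \<partial>T) = (\<integral>\<^sup>+\<omega>. (\<integral>\<^sup>+y. (\<integral>\<^sup>+a. f (y, a) \<partial>\<pi> n (restrict \<omega> {0..<n}, y))
    \<partial>next_state P x n (restrict \<omega> {0..<n})) \<partial>T)"
  unfolding nn_integral_lim_coordinate[OF f, of n, folded trajectory_eq_lim]
  by (intro nn_integral_cong nn_integral_stage_law restrict_trajectory next_state_in_prob_algebra f)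

lemma prob_space_policy:
  assumes "\<omega> \<in> space T" "y \<in> states P"
  shows "\<pi> n (restrict \<omega> {0..<n}, y) \<in> space (prob_algebra (count_space UNIV))"
proof -
  have "\<pi> n \<in> PiM {0..<n} (\<lambda>_. stage_space P) \<Otimes>\<^sub>M state_space P
      \<rightarrow>\<^sub>M prob_algebra (count_space UNIV)"
    using policy by (simp add: policies_def)
  moreover have "(restrict \<omega> {0..<n}, y) \<in> space (PiM {0..<n} (\<lambda>_. stage_space P) \<Otimes>\<^sub>M state_space P)"
    using restrict_trajectory assms by (simp add: space_pair_measure)
  ultimately show ?thesis by (rule measurable_space)
qed

lemma space_next_state:
  "\<omega> \<in> space T \<Longrightarrow> space (next_state P x n (restrict \<omega> {0..<n})) = states P"
  using next_state_in_prob_algebra[of \<omega> n]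
    sets_eq_imp_space_eq[of "next_state P x n (restrict \<omega> {0..<n})" "state_space P"]
  by (simp add: space_prob_algebra)

text \<open>The integrand ignores the action, whose conditional law has mass 1 and integrates
  out.\<close>

lemma nn_integral_state:
  assumes h[measurable]: "h \<in> borel_measurable (state_space P)"
  shows "(\<integral>\<^sup>+\<omega>. h (fst (\<omega> n)) \<partial>T) = (\<integral>\<^sup>+\<omega>. (\<integral>\<^sup>+y. h y \<partial>next_state P x n (restrict \<omega> {0..<n})) \<partial>T)"
proof -
  have "(\<lambda>p. h (fst p)) \<in> borel_measurable (stage_space P)"
    by (rule measurable_stage[of "\<lambda>y a. h y"]) simp
  note nn_integral_coordinate[OF this, of n]
  also have "(\<integral>\<^sup>+\<omega>. (\<integral>\<^sup>+y. (\<integral>\<^sup>+a. h (fst (y, a)) \<partial>\<pi> n (restrict \<omega> {0..<n}, y))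
      \<partial>next_state P x n (restrict \<omega> {0..<n})) \<partial>T)
    = (\<integral>\<^sup>+\<omega>. (\<integral>\<^sup>+y. h y \<partial>next_state P x n (restrict \<omega> {0..<n})) \<partial>T)"
    using prob_space_policy
    by (intro nn_integral_cong)
       (auto simp: space_next_state space_prob_algebra prob_space.emeasure_space_1)
  finally show ?thesis .
qed

lemma nn_integral_state_0:
  assumes "h \<in> borel_measurable (state_space P)"
  shows "(\<integral>\<^sup>+\<omega>. h (fst (\<omega> 0)) \<partial>T) = h x"
  using nn_integral_state[OF assms, of 0] assms x
  by (simp add: next_state_def nn_integral_return T.emeasure_space_1)

text \<open>Controlled Markov property: at time \<open>Suc n\<close>, \<open>next_state\<close>
  reads only the last pair of the history, so the policy enters through the action already
  taken.\<close>

lemma nn_integral_state_Suc: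
  assumes "h \<in> borel_measurable (state_space P)"
  shows "(\<integral>\<^sup>+\<omega>. h (fst (\<omega> (Suc n))) \<partial>T)
    = (\<integral>\<^sup>+\<omega>. (\<integral>\<^sup>+y. h y \<partial>kernel P (snd (\<omega> n)) (fst (\<omega> n))) \<partial>T)"
  using nn_integral_state[OF assms, of "Suc n"] by (simp add: next_state_def)

text \<open>The indicator \<open>f\<close> of a deviation from \<open>g\<close> has integral 0 under
  each point mass \<open>\<pi> n (h, y)\<close>, hence also along the trajectory.\<close>

lemma AE_action:
  assumes pol: "\<And>h y. \<pi> n (h, y) = return (count_space UNIV) (g y)"
    and g[measurable]: "g \<in> state_space P \<rightarrow>\<^sub>M count_space UNIV"
  shows "AE \<omega> in T. snd (\<omega> n) = g (fst (\<omega> n))"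
proof -
  define f where "f p = (if snd p = g (fst p) then 0 else 1 :: ennreal)" for p :: "real \<times> bool"
  have f[measurable]: "f \<in> borel_measurable (stage_space P)"
    unfolding f_def[abs_def] stage_space_def by measurable
  have "(\<integral>\<^sup>+\<omega>. f (\<omega> n) \<partial>T) = 0"
    unfolding nn_integral_coordinate[OF f] pol
    by (simp add: f_def nn_integral_return)
  then have "AE \<omega> in T. f (\<omega> n) = 0"
    by (subst (asm) nn_integral_0_iff_AE) auto
  then show ?thesis by eventually_elim (simp add: f_def split: if_splits)
qed

text \<open>Iterated drift: each period trades a factor \<open>\<beta>\<close> for a factor
  \<open>\<gamma>\<close>. Nonnegative integrals remain meaningful when \<open>w\<close> is not
  integrable, and a zero discount factor then annihilates an infinite integral.\<close>

lemma nn_integral_weight_le: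
  "ennreal (\<beta> ^ n) * (\<integral>\<^sup>+\<omega>. ennreal (w (fst (\<omega> n))) \<partial>T) \<le> ennreal (\<gamma> ^ n * w x)"
proof (induction n)
  case 0
  show ?case using nn_integral_state_0[of "\<lambda>y. ennreal (w y)"] by simp
next
  case (Suc n)
  let ?I = "\<lambda>\<omega>. \<integral>\<^sup>+y. ennreal (w y) \<partial>kernel P (snd (\<omega> n)) (fst (\<omega> n))"
  have [measurable]: "?I \<in> borel_measurable T"
    by (rule measurable_compose[OF coordinate_measurable
          measurable_compose[OF kernel_stage_measurable nn_integral_measurable_subprob_algebra]])
       simp
  have "ennreal (\<beta> ^ Suc n) * (\<integral>\<^sup>+\<omega>. ennreal (w (fst (\<omega> (Suc n)))) \<partial>T)
      = ennreal (\<beta> ^ n) * (\<integral>\<^sup>+\<omega>. ennreal \<beta> * ?I \<omega> \<partial>T)"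
    using nn_integral_state_Suc[of "\<lambda>y. ennreal (w y)" n] \<beta>
    by (simp add: nn_integral_cmult ennreal_mult mult_ac)
  also have "\<dots> \<le> ennreal (\<beta> ^ n) * (\<integral>\<^sup>+\<omega>. ennreal (\<gamma> * w (fst (\<omega> n))) \<partial>T)"
    by (intro mult_left_mono nn_integral_mono drift space_trajectory) auto
  also have "\<dots> = ennreal \<gamma> * (ennreal (\<beta> ^ n) * (\<integral>\<^sup>+\<omega>. ennreal (w (fst (\<omega> n))) \<partial>T))"
    using \<gamma>_nonneg by (simp add: ennreal_mult' nn_integral_cmult mult_ac)
  also have "\<dots> \<le> ennreal \<gamma> * ennreal (\<gamma> ^ n * w x)"
    by (intro mult_left_mono Suc) auto
  also have "\<dots> = ennreal (\<gamma> ^ Suc n * w x)"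
    using \<gamma>_nonneg by (simp add: ennreal_mult'[symmetric] mult_ac)
  finally show ?case .
qed

section \<open>Expected discounted stage rewards\<close>

abbreviation discounted :: "(real \<Rightarrow> bool \<Rightarrow> real) \<Rightarrow> nat \<Rightarrow> (nat \<Rightarrow> real \<times> bool) \<Rightarrow> real" where
  "discounted g n \<omega> \<equiv> \<beta> ^ n * g (fst (\<omega> n)) (snd (\<omega> n))"

lemma stage_bounded_measurable:
  assumes "stage_bounded K g"
  shows "(\<lambda>\<omega>. g (fst (\<omega> n)) (snd (\<omega> n))) \<in> borel_measurable T"
  using measurable_compose[OF coordinate_measurable measurable_stage[of g]] assms
  by (auto simp: stage_bounded_def weight_bounded_def)

lemma nn_integral_discounted_le:
  assumes g: "stage_bounded K g"
  shows "(\<integral>\<^sup>+\<omega>. ennreal \<bar>discounted g n \<omega>\<bar> \<partial>T) \<le> ennreal (K * \<gamma> ^ n * w x)"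
proof -
  have K: "0 \<le> K" using g weight_bounded_nonneg by (auto simp: stage_bounded_def)
  have "(\<integral>\<^sup>+\<omega>. ennreal \<bar>discounted g n \<omega>\<bar> \<partial>T)
      \<le> (\<integral>\<^sup>+\<omega>. ennreal K * (ennreal (\<beta> ^ n) * ennreal (w (fst (\<omega> n)))) \<partial>T)"
  proof (rule nn_integral_mono)
    fix \<omega> assume "\<omega> \<in> space T"
    then have "\<bar>g (fst (\<omega> n)) (snd (\<omega> n))\<bar> \<le> K * w (fst (\<omega> n))"
      using g space_trajectory by (auto simp: stage_bounded_def weight_bounded_def)
    then have "\<bar>discounted g n \<omega>\<bar> \<le> \<beta> ^ n * (K * w (fst (\<omega> n)))"
      using \<beta> by (auto simp: abs_mult intro!: mult_left_mono)
    then show "ennreal \<bar>discounted g n \<omega>\<bar> \<le> ennreal K * (ennreal (\<beta> ^ n) * ennreal (w (fst (\<omega> n))))"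
      using K \<beta> by (simp add: ennreal_mult'[symmetric] mult_ac ennreal_leI)
  qed
  also have "\<dots> = ennreal K * (ennreal (\<beta> ^ n) * (\<integral>\<^sup>+\<omega>. ennreal (w (fst (\<omega> n))) \<partial>T))"
    by (simp add: nn_integral_cmult)
  also have "\<dots> \<le> ennreal K * ennreal (\<gamma> ^ n * w x)"
    by (intro mult_left_mono nn_integral_weight_le) auto
  also have "\<dots> = ennreal (K * \<gamma> ^ n * w x)"
    using K by (simp add: ennreal_mult'[symmetric] mult_ac)
  finally show ?thesis .
qed

lemma integrable_discounted:
  assumes "stage_bounded K g"
  shows "integrable T (discounted g n)"
proof (rule integrableI_bounded)
  show "discounted g n \<in> borel_measurable T"
    using stage_bounded_measurable[OF assms] by measurable
  show "(\<integral>\<^sup>+\<omega>. ennreal (norm (discounted g n \<omega>)) \<partial>T) < \<infinity>"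
    using nn_integral_discounted_le[OF assms, of n] by (auto intro: le_less_trans)
qed

lemma integral_abs_discounted_le:
  assumes "stage_bounded K g"
  shows "(\<integral>\<omega>. \<bar>discounted g n \<omega>\<bar> \<partial>T) \<le> K * \<gamma> ^ n * w x"
proof -
  have K: "0 \<le> K" using assms weight_bounded_nonneg by (auto simp: stage_bounded_def)
  have "ennreal (\<integral>\<omega>. \<bar>discounted g n \<omega>\<bar> \<partial>T) \<le> ennreal (K * \<gamma> ^ n * w x)"
    using nn_integral_discounted_le[OF assms, of n]
      nn_integral_eq_integral[OF integrable_abs[OF integrable_discounted[OF assms]], of n] by simp
  then show ?thesis using K \<gamma>_nonneg w_nonneg[OF x] by simp
qed

definition expected :: "(real \<Rightarrow> bool \<Rightarrow> real) \<Rightarrow> nat \<Rightarrow> real" where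
  "expected g n = (\<integral>\<omega>. discounted g n \<omega> \<partial>T)"

lemma abs_expected_le:
  "stage_bounded K g \<Longrightarrow> \<bar>expected g n\<bar> \<le> K * w x * \<gamma> ^ n"
  using integral_abs_bound[of T "discounted g n"] integral_abs_discounted_le[of K g n]
  by (simp add: expected_def mult_ac)

lemma summable_geometric_bound: "summable (\<lambda>n. K * w x * \<gamma> ^ n)"
  using \<gamma> \<gamma>_nonneg by (intro summable_mult summable_geometric) simp

lemma summable_expected: "stage_bounded K g \<Longrightarrow> summable (expected g)"
  by (rule summable_comparison_test'[OF summable_geometric_bound[of K], of 0])
     (simp add: abs_expected_le)

text \<open>The expected absolute terms lie below a geometric sequence, so expectation and sum may
  be exchanged.\<close>

lemma discounted_total_eq_suminf:
  assumes g: "stage_bounded K g"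
  shows "discounted_total P g x \<pi> = (\<Sum>n. expected g n)"
proof -
  note [measurable] = stage_bounded_measurable[OF g]
  have s: "summable (\<lambda>n. \<integral>\<omega>. norm (discounted g n \<omega>) \<partial>T)"
    by (rule summable_comparison_test'[OF summable_geometric_bound[of K], of 0])
       (use integral_abs_discounted_le[OF g] in \<open>simp add: mult_ac\<close>)
  \<comment> \<open>\<open>integral_suminf\<close> also requires almost sure absolute summability.
    It follows because the sum of absolute terms has a finite integral.\<close>
  have "(\<integral>\<^sup>+\<omega>. (\<Sum>n. ennreal \<bar>discounted g n \<omega>\<bar>) \<partial>T) = (\<Sum>n. \<integral>\<^sup>+\<omega>. ennreal \<bar>discounted g n \<omega>\<bar> \<partial>T)"
    by (intro nn_integral_suminf) measurable
  also have "\<dots> = (\<Sum>n. ennreal (\<integral>\<omega>. norm (discounted g n \<omega>) \<partial>T))"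
    using nn_integral_eq_integral[OF integrable_abs[OF integrable_discounted[OF g]]] by simp
  also have "\<dots> < \<infinity>"
    using s by (simp add: suminf_ennreal2)
  finally have "AE \<omega> in T. (\<Sum>n. ennreal \<bar>discounted g n \<omega>\<bar>) \<noteq> \<infinity>"
    by (intro nn_integral_PInf_AE) (auto, measurable)
  then have "AE \<omega> in T. summable (\<lambda>n. norm (discounted g n \<omega>))"
    by eventually_elim (auto intro!: summable_suminf_not_top)
  from integral_suminf[OF integrable_discounted[OF g] this s] show ?thesis
    by (simp add: discounted_total_def expected_def)
qed

lemma expected_0:
  assumes h: "weight_bounded K h"
  shows "expected (\<lambda>y a. h y) 0 = h x"
proof -
  note [measurable] = weight_bounded_measurable[OF h]
  have "AE \<omega> in T. fst (\<omega> 0) = x"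
  proof -
    have [measurable]: "(\<lambda>y. if y = x then 0 else 1 :: ennreal) \<in> borel_measurable (state_space P)"
      unfolding state_space_def by (rule measurable_restrict_space1) measurable
    have "(\<integral>\<^sup>+\<omega>. (if fst (\<omega> 0) = x then 0 else 1 :: ennreal) \<partial>T) = 0"
      using nn_integral_state_0[of "\<lambda>y. if y = x then 0 else 1"] by simp
    then have "AE \<omega> in T. (if fst (\<omega> 0) = x then 0 else 1 :: ennreal) = 0"
      by (subst (asm) nn_integral_0_iff_AE) auto
    then show ?thesis by eventually_elim (simp split: if_splits)
  qed
  then have "expected (\<lambda>y a. h y) 0 = (\<integral>\<omega>. h x \<partial>T)"
    unfolding expected_def by (intro integral_cong_AE) (auto elim: eventually_mono)
  then show ?thesis by (simp add: T.prob_space)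
qed

text \<open>For nonnegative \<open>h\<close> the Bochner integrals are real values of nonnegative
  ones, to which the Markov property applies. With discount factor 0 both sides vanish.\<close>

lemma expected_Suc_nonneg:
  assumes h: "weight_bounded K h" and pos: "\<And>y. y \<in> states P \<Longrightarrow> 0 \<le> h y"
  shows "expected (\<lambda>y a. h y) (Suc n) = expected (\<lambda>y a. \<beta> * (\<integral>z. h z \<partial>kernel P a y)) n"
proof (cases "\<beta> = 0")
  case True then show ?thesis by (simp add: expected_def)
next
  case False
  then have b: "0 < \<beta>" using \<beta> by simp
  let ?k = "\<lambda>\<omega>. \<integral>z. h z \<partial>kernel P (snd (\<omega> n)) (fst (\<omega> n))"
  note [measurable] = weight_bounded_measurable[OF h]
  have [measurable]: "?k \<in> borel_measurable T"
    by (rule measurable_compose[OF coordinate_measurable measurable_stage]) measurable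
  have k: "(\<integral>\<^sup>+z. ennreal (h z) \<partial>kernel P a y) = ennreal (\<integral>z. h z \<partial>kernel P a y)"
    if "y \<in> states P" for a y
    using weight_bounded_kernel_integrable[OF h that b] pos
    by (intro nn_integral_eq_integral) (auto simp: space_kernel[OF that])
  have "(\<integral>\<omega>. h (fst (\<omega> (Suc n))) \<partial>T) = enn2real (\<integral>\<^sup>+\<omega>. ennreal (h (fst (\<omega> (Suc n)))) \<partial>T)"
    using space_trajectory pos by (intro integral_eq_nn_integral) auto
  also have "(\<integral>\<^sup>+\<omega>. ennreal (h (fst (\<omega> (Suc n)))) \<partial>T) = (\<integral>\<^sup>+\<omega>. ennreal (?k \<omega>) \<partial>T)"
    using nn_integral_state_Suc[of "\<lambda>y. ennreal (h y)" n] k space_trajectory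
    by (auto intro: nn_integral_cong)
  also have "enn2real \<dots> = (\<integral>\<omega>. ?k \<omega> \<partial>T)"
    using space_trajectory pos
    by (intro integral_eq_nn_integral[symmetric])
       (auto intro!: AE_I2 integral_nonneg_AE simp: space_kernel)
  finally show ?thesis by (simp add: expected_def mult_ac)
qed

lemma stage_bounded_state: "weight_bounded K h \<Longrightarrow> stage_bounded K (\<lambda>y a. h y)"
  by (simp add: stage_bounded_def)

lemma expected_add:
  assumes "stage_bounded K f" "stage_bounded L g"
  shows "expected (\<lambda>y a. f y a + g y a) n = expected f n + expected g n"
  using integrable_discounted[OF assms(1), of n] integrable_discounted[OF assms(2), of n]
  by (simp add: expected_def distrib_left)

lemma expected_cmult: "expected (\<lambda>y a. c * g y a) n = c * expected g n"
  by (simp add: expected_def mult.left_commute)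

lemma expected_cong_AE:
  assumes "stage_bounded K f" "stage_bounded L g"
    and "AE \<omega> in T. f (fst (\<omega> n)) (snd (\<omega> n)) = g (fst (\<omega> n)) (snd (\<omega> n))"
  shows "expected f n = expected g n"
  unfolding expected_def
proof (rule integral_cong_AE)
  show "AE \<omega> in T. discounted f n \<omega> = discounted g n \<omega>"
    using assms(3) by (auto elim: eventually_mono)
qed (use integrable_discounted[OF assms(1)] integrable_discounted[OF assms(2)]
      in \<open>blast dest: borel_measurable_integrable\<close>)+

lemma expected_cong:
  assumes "\<And>y a. y \<in> states P \<Longrightarrow> f y a = g y a"
  shows "expected f n = expected g n"
  unfolding expected_def
  by (intro Bochner_Integration.integral_cong) (simp_all add: assms space_trajectory)

lemma expected_mono:
  assumes "stage_bounded K f" "stage_bounded L g"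
    and "\<And>y a. y \<in> states P \<Longrightarrow> f y a \<le> g y a"
  shows "expected f n \<le> expected g n"
  unfolding expected_def
  using integrable_discounted[OF assms(1), of n] integrable_discounted[OF assms(2), of n] assms(3) \<beta>
  by (intro integral_mono) (auto simp: space_trajectory intro: mult_left_mono)

text \<open>Splitting \<open>h\<close> into its positive part \<open>p\<close> and negative part
  \<open>m\<close> reduces the claim to the nonnegative case.\<close>

lemma expected_Suc:
  assumes h: "weight_bounded K h"
  shows "expected (\<lambda>y a. h y) (Suc n) = expected (\<lambda>y a. \<beta> * (\<integral>z. h z \<partial>kernel P a y)) n"
proof -
  have sb: "stage_bounded (L * \<gamma>) (\<lambda>y a. \<beta> * (\<integral>z. f z \<partial>kernel P a y))" if "weight_bounded L f" for L f
    using weight_bounded_discounted_kernel[OF that] by (simp add: stage_bounded_def)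
  define p where "p y = max (h y) 0" for y
  define m where "m y = max (- h y) 0" for y
  note [measurable] = weight_bounded_measurable[OF h]
  have [measurable]: "p \<in> borel_measurable (state_space P)" "m \<in> borel_measurable (state_space P)"
    unfolding p_def[abs_def] m_def[abs_def] by measurable
  have p: "weight_bounded K p" and m: "weight_bounded K m"
    using h weight_bounded_nonneg[OF h] w_nonneg by (auto simp: weight_bounded_def p_def m_def abs_le_iff)
  have h_eq: "h = (\<lambda>y. p y + (-1) * m y)" by (auto simp: p_def m_def)
  have m': "weight_bounded K (\<lambda>y. (-1) * m y)"
    using weight_bounded_cmult[OF m, of "-1"] by simp
  have "expected (\<lambda>y a. h y) (Suc n) = expected (\<lambda>y a. p y) (Suc n) + (-1) * expected (\<lambda>y a. m y) (Suc n)"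
    unfolding h_eq expected_cmult[symmetric]
    by (rule expected_add[OF stage_bounded_state[OF p] stage_bounded_state[OF m']])
  also have "\<dots> = expected (\<lambda>y a. \<beta> * (\<integral>z. p z \<partial>kernel P a y)) n
      + (-1) * expected (\<lambda>y a. \<beta> * (\<integral>z. m z \<partial>kernel P a y)) n"
    using expected_Suc_nonneg[OF p] expected_Suc_nonneg[OF m] by (simp add: p_def m_def)
  also have "\<dots> = expected (\<lambda>y a. \<beta> * (\<integral>z. p z \<partial>kernel P a y) + \<beta> * (\<integral>z. (-1) * m z \<partial>kernel P a y)) n"
    using expected_add[OF sb[OF p] sb[OF m'], of n]
      expected_cmult[of "-1" "\<lambda>y a. \<beta> * (\<integral>z. m z \<partial>kernel P a y)" n] by simp
  also have "\<dots> = expected (\<lambda>y a. \<beta> * (\<integral>z. h z \<partial>kernel P a y)) n"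
  proof (rule expected_cong)
    fix y a assume y: "y \<in> states P"
    show "\<beta> * (\<integral>z. p z \<partial>kernel P a y) + \<beta> * (\<integral>z. (-1) * m z \<partial>kernel P a y)
        = \<beta> * (\<integral>z. h z \<partial>kernel P a y)"
    \<comment> \<open>Linearity of the kernel integral needs integrability, which is available for a
      positive discount factor; otherwise both sides are 0.\<close>
    proof (cases "\<beta> = 0")
      case False
      then have "0 < \<beta>" using \<beta> by simp
      then show ?thesis
        using weight_bounded_kernel_integrable[OF p y, of a] weight_bounded_kernel_integrable[OF m y, of a]
        by (simp add: h_eq right_diff_distrib)
    qed simp
  qed
  finally show ?thesis .
qed

end

section \<open>The optimal value as a limit of finite-horizon values\<close>

text \<open>Here \<open>n\<close> counts the periods left after the current one. Ties go to the
  active action.\<close>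

definition (in weighted_project) greedy :: "real \<Rightarrow> nat \<Rightarrow> real \<Rightarrow> bool" where
  "greedy \<nu> n x \<longleftrightarrow>
     stage_value \<nu> (horizon_value \<nu> n) False x \<le> stage_value \<nu> (horizon_value \<nu> n) True x"

context controlled_project
begin

lemma stage_bounded_reward: "stage_bounded M (reward P)"
  and stage_bounded_consumption: "stage_bounded M (consumption P)"
  and stage_bounded_net_reward: "stage_bounded ((1 + \<bar>\<nu>\<bar>) * M) (net_reward \<nu>)"
  using weight_bounded_reward weight_bounded_consumption weight_bounded_net_reward
  by (auto simp: stage_bounded_def)

lemma net_value_eq_suminf: "net_value P \<nu> x \<pi> = (\<Sum>n. expected (net_reward \<nu>) n)"
proof -
  have c: "stage_bounded (\<bar>- \<nu>\<bar> * M) (\<lambda>y a. - \<nu> * consumption P y a)"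
    unfolding stage_bounded_def by (intro allI weight_bounded_cmult weight_bounded_consumption)
  have "expected (net_reward \<nu>) n = expected (reward P) n - \<nu> * expected (consumption P) n" for n
    using expected_add[OF stage_bounded_reward c, of n] expected_cmult[of "- \<nu>" "consumption P" n]
    by (simp add: net_reward_def[abs_def])
  then have "expected (net_reward \<nu>) sums
      ((\<Sum>n. expected (reward P) n) - \<nu> * (\<Sum>n. expected (consumption P) n))"
    using sums_diff[OF summable_sums[OF summable_expected[OF stage_bounded_reward]]
        sums_mult[OF summable_sums[OF summable_expected[OF stage_bounded_consumption]], of \<nu>]]
    by presburger
  then show ?thesis
    by (simp add: net_value_def reward_measure_def resource_measure_def sums_iff
        discounted_total_eq_suminf[OF stage_bounded_reward]
        discounted_total_eq_suminf[OF stage_bounded_consumption])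
qed

text \<open>The terms from time \<open>N\<close> on are dominated by a geometric series of ratio
  \<open>\<gamma>\<close>.\<close>

lemma abs_suminf_expected_tail_le:
  assumes g: "stage_bounded K g"
  shows "\<bar>(\<Sum>n. expected g n) - (\<Sum>n<N. expected g n)\<bar> \<le> K * w x * \<gamma> ^ N / (1 - \<gamma>)"
proof -
  have s: "(\<lambda>n. K * w x * \<gamma> ^ (n + N)) sums (K * w x * \<gamma> ^ N / (1 - \<gamma>))"
    using sums_mult[OF geometric_sums[of \<gamma>], of "K * w x * \<gamma> ^ N"] \<gamma> \<gamma>_nonneg
    by (simp add: power_add mult_ac)
  have abs_s: "summable (\<lambda>n. \<bar>expected g (n + N)\<bar>)"
    by (rule summable_comparison_test'[OF sums_summable[OF s], of 0]) (simp add: abs_expected_le[OF g])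
  have "\<bar>\<Sum>n. expected g (n + N)\<bar> \<le> (\<Sum>n. \<bar>expected g (n + N)\<bar>)"
    by (rule summable_rabs[OF abs_s])
  also have "\<dots> \<le> (\<Sum>n. K * w x * \<gamma> ^ (n + N))"
    by (rule suminf_le[OF abs_expected_le[OF g] abs_s sums_summable[OF s]])
  finally have "\<bar>\<Sum>n. expected g (n + N)\<bar> \<le> (\<Sum>n. K * w x * \<gamma> ^ (n + N))" .
  then show ?thesis
    using suminf_minus_initial_segment[OF summable_expected[OF g], of N] sums_unique[OF s] by simp
qed

text \<open>The tail estimate with an empty partial sum. The bound is uniform over policies and
  becomes a Lipschitz constant in the price.\<close>

lemma abs_resource_measure_le: "\<bar>resource_measure P x \<pi>\<bar> \<le> M * w x / (1 - \<gamma>)"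
  using abs_suminf_expected_tail_le[OF stage_bounded_consumption, of 0]
  by (simp add: resource_measure_def discounted_total_eq_suminf[OF stage_bounded_consumption])

section \<open>Telescoping finite-horizon values along the trajectory\<close>

text \<open>\<open>expected_Suc\<close> pulls the continuation back from time \<open>Suc n\<close>
  to time \<open>n\<close>, where it joins the reward in a one-step lookahead.\<close>

lemma expected_net_reward_add_horizon_value:
  "expected (net_reward \<nu>) n + expected (\<lambda>y a. horizon_value \<nu> m y) (Suc n)
    = expected (\<lambda>y a. stage_value \<nu> (horizon_value \<nu> m) a y) n"
proof -
  obtain K where K: "weight_bounded K (horizon_value \<nu> m)" using weight_bounded_horizon_value ..
  have "stage_bounded (K * \<gamma>) (\<lambda>y a. \<beta> * (\<integral>z. horizon_value \<nu> m z \<partial>kernel P a y))"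
    using weight_bounded_discounted_kernel[OF K] by (simp add: stage_bounded_def)
  from expected_add[OF stage_bounded_net_reward this] show ?thesis
    by (simp add: expected_Suc[OF K] stage_value_def)
qed

lemma stage_bounded_stage_value:
  "\<exists>K. stage_bounded K (\<lambda>y a. stage_value \<nu> (horizon_value \<nu> m) a y)"
  unfolding stage_bounded_def using weight_bounded_horizon_value[of \<nu> m] weight_bounded_stage_value
  by blast

lemma stage_bounded_horizon_value: "\<exists>K. stage_bounded K (\<lambda>y a. horizon_value \<nu> m y)"
  using weight_bounded_horizon_value[of \<nu> m] stage_bounded_state by blast

lemma expected_horizon_value_0: "expected (\<lambda>y a. horizon_value \<nu> m y) 0 = horizon_value \<nu> m x"
  using weight_bounded_horizon_value[of \<nu> m] expected_0 by blast

text \<open>Replacing the last reward and the continuation by a continuation that is one period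
  longer passes from \<open>(Suc k, m)\<close> to \<open>(k, Suc m)\<close> and can only increase
  the left side. Hence \<open>m\<close> varies in the induction.\<close>

lemma horizon_value_upper:
  "(\<Sum>t<k. expected (net_reward \<nu>) t) + expected (\<lambda>y a. horizon_value \<nu> m y) k
    \<le> horizon_value \<nu> (m + k) x"
proof (induction k arbitrary: m)
  case 0
  then show ?case by (simp add: expected_horizon_value_0)
next
  case (Suc k)
  have "stage_value \<nu> (horizon_value \<nu> m) a y \<le> horizon_value \<nu> (Suc m) y" for a y
    by (cases a) auto
  then have "expected (\<lambda>y a. stage_value \<nu> (horizon_value \<nu> m) a y) k
      \<le> expected (\<lambda>y a. horizon_value \<nu> (Suc m) y) k"
    using stage_bounded_stage_value[of \<nu> m] stage_bounded_horizon_value[of \<nu> "Suc m"] expected_mono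
    by blast
  with Suc[of "Suc m"] expected_net_reward_add_horizon_value[of \<nu> k m] show ?case
    by (simp del: horizon_value.simps)
qed

text \<open>At time \<open>t\<close>, \<open>m + k - Suc t\<close> periods remain after the current
  one, so the greedy action attains the maximum in \<open>horizon_value\<close> and the telescoping
  is exact. The assumption depends on \<open>m + k\<close> alone, which the induction
  preserves.\<close>

lemma horizon_value_greedy:
  assumes "\<And>t. t < m + k \<Longrightarrow> AE \<omega> in T. snd (\<omega> t) = greedy \<nu> (m + k - Suc t) (fst (\<omega> t))"
  shows "(\<Sum>t<k. expected (net_reward \<nu>) t) + expected (\<lambda>y a. horizon_value \<nu> m y) k
    = horizon_value \<nu> (m + k) x"
  using assms
proof (induction k arbitrary: m)
  case 0
  then show ?case by (simp add: expected_horizon_value_0)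
next
  case (Suc k)
  have "AE \<omega> in T. snd (\<omega> k) = greedy \<nu> m (fst (\<omega> k))"
    using Suc.prems[of k] by simp
  then have "AE \<omega> in T. stage_value \<nu> (horizon_value \<nu> m) (snd (\<omega> k)) (fst (\<omega> k))
      = horizon_value \<nu> (Suc m) (fst (\<omega> k))"
    by eventually_elim (auto simp: greedy_def max_def)
  moreover obtain K where "stage_bounded K (\<lambda>y a. stage_value \<nu> (horizon_value \<nu> m) a y)"
    using stage_bounded_stage_value ..
  moreover obtain L where "stage_bounded L (\<lambda>y a. horizon_value \<nu> (Suc m) y)"
    using stage_bounded_horizon_value ..
  ultimately have "expected (\<lambda>y a. stage_value \<nu> (horizon_value \<nu> m) a y) k
      = expected (\<lambda>y a. horizon_value \<nu> (Suc m) y) k"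
    by (intro expected_cong_AE)
  with Suc.IH[of "Suc m"] Suc.prems expected_net_reward_add_horizon_value[of \<nu> k m] show ?case
    by (simp del: horizon_value.simps)
qed

lemma expected_zero: "expected (\<lambda>y a. 0) n = 0"
  by (simp add: expected_def)

text \<open>For \<open>m = 0\<close> the continuation vanishes and the first \<open>N\<close>
  rewards remain; the error term is the tail.\<close>

lemma net_value_upper:
  "net_value P \<nu> x \<pi> \<le> horizon_value \<nu> N x + (1 + \<bar>\<nu>\<bar>) * M * w x * \<gamma> ^ N / (1 - \<gamma>)"
  using horizon_value_upper[where k=N and m=0 and \<nu>=\<nu>]
    abs_suminf_expected_tail_le[OF stage_bounded_net_reward, of \<nu> N]
  by (simp add: net_value_eq_suminf expected_zero)

lemma net_value_greedy:
  assumes "\<And>t. t < N \<Longrightarrow> AE \<omega> in T. snd (\<omega> t) = greedy \<nu> (N - Suc t) (fst (\<omega> t))"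
  shows "horizon_value \<nu> N x - (1 + \<bar>\<nu>\<bar>) * M * w x * \<gamma> ^ N / (1 - \<gamma>) \<le> net_value P \<nu> x \<pi>"
  using horizon_value_greedy[of 0 N \<nu>] assms
    abs_suminf_expected_tail_le[OF stage_bounded_net_reward, of \<nu> N]
  by (simp add: net_value_eq_suminf expected_zero)

end

section \<open>Greedy policies and convergence to the optimal value\<close>

context weighted_project
begin

text \<open>From time \<open>N\<close> on, truncated subtraction makes the policy repeat
  \<open>greedy \<nu> 0\<close>; those actions affect only the discounted tail.\<close>

definition greedy_policy :: "real \<Rightarrow> nat \<Rightarrow> policy" where
  "greedy_policy \<nu> N n p = return (count_space UNIV) (greedy \<nu> (N - Suc n) (snd p))"

lemma greedy_measurable[measurable]: "greedy \<nu> n \<in> state_space P \<rightarrow>\<^sub>M count_space UNIV"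
proof -
  obtain K where "weight_bounded K (horizon_value \<nu> n)" using weight_bounded_horizon_value ..
  note [measurable] = weight_bounded_stage_value[OF this, THEN weight_bounded_measurable]
  show ?thesis unfolding greedy_def[abs_def] by measurable
qed

lemma greedy_policy: "greedy_policy \<nu> N \<in> policies P"
  unfolding policies_def greedy_policy_def[abs_def]
  by (auto intro!: measurable_compose[OF _ measurable_return_prob_space])

lemma controlled_projectI:
  "\<pi> \<in> policies P \<Longrightarrow> x \<in> states P \<Longrightarrow> controlled_project P w M \<gamma> \<pi> x"
  by (intro controlled_project.intro weighted_project_axioms controlled_project_axioms.intro)

lemma abs_optimal_value_diff_le:
  assumes x: "x \<in> states P"
  shows "\<bar>optimal_value P \<nu> x - horizon_value \<nu> N x\<bar> \<le> (1 + \<bar>\<nu>\<bar>) * M * w x * \<gamma> ^ N / (1 - \<gamma>)"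
    (is "_ \<le> ?B")
proof -
  have le: "net_value P \<nu> x \<pi> \<le> horizon_value \<nu> N x + ?B" if "\<pi> \<in> policies P" for \<pi>
    by (rule controlled_project.net_value_upper[OF controlled_projectI[OF that x]])
  then have "optimal_value P \<nu> x \<le> horizon_value \<nu> N x + ?B"
    unfolding optimal_value_def using greedy_policy by (intro cSUP_least) auto
  moreover have "horizon_value \<nu> N x - ?B \<le> net_value P \<nu> x (greedy_policy \<nu> N)"
  proof -
    interpret controlled_project P w M \<gamma> "greedy_policy \<nu> N" x
      by (rule controlled_projectI[OF greedy_policy x])
    show ?thesis
      by (intro net_value_greedy AE_action) (simp_all add: greedy_policy_def)
  qed
  \<comment> \<open>The supremum is taken in the reals, so it bounds a member only for a set bounded
    above, which \<open>le\<close> ensures.\<close>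
  moreover have "net_value P \<nu> x (greedy_policy \<nu> N) \<le> optimal_value P \<nu> x"
    unfolding optimal_value_def using greedy_policy le by (intro cSUP_upper bdd_aboveI2) auto
  ultimately show ?thesis by (simp add: abs_le_iff)
qed

lemma weight_bounded_optimal_value:
  "weight_bounded ((1 + \<bar>\<nu>\<bar>) * M / (1 - \<gamma>)) (optimal_value P \<nu>)"
proof -
  have "(\<lambda>N. horizon_value \<nu> N x) \<longlonglongrightarrow> optimal_value P \<nu> x" if x: "x \<in> states P" for x
  proof (rule LIM_zero_cancel, rule Lim_null_comparison)
    have "(\<lambda>N. (1 + \<bar>\<nu>\<bar>) * M * w x / (1 - \<gamma>) * \<gamma> ^ N) \<longlonglongrightarrow> (1 + \<bar>\<nu>\<bar>) * M * w x / (1 - \<gamma>) * 0"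
      using \<gamma> \<gamma>_nonneg by (intro tendsto_intros LIMSEQ_power_zero) auto
    then show "(\<lambda>N. (1 + \<bar>\<nu>\<bar>) * M * w x * \<gamma> ^ N / (1 - \<gamma>)) \<longlonglongrightarrow> 0" by simp
    show "\<forall>\<^sub>F N in sequentially. norm (horizon_value \<nu> N x - optimal_value P \<nu> x)
        \<le> (1 + \<bar>\<nu>\<bar>) * M * w x * \<gamma> ^ N / (1 - \<gamma>)"
      using abs_optimal_value_diff_le[OF x] by (simp add: abs_minus_commute)
  qed
  moreover have "horizon_value \<nu> N \<in> borel_measurable (state_space P)" for N
    using weight_bounded_horizon_value weight_bounded_measurable by blast
  ultimately have "optimal_value P \<nu> \<in> borel_measurable (state_space P)"
    by (rule borel_measurable_LIMSEQ_real[where u="horizon_value \<nu>"]) simp_all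
  then show ?thesis
    \<comment> \<open>At horizon 0 the approximation is 0, so the error bound is a bound on the
      optimal value itself.\<close>
    using abs_optimal_value_diff_le[of _ \<nu> 0] by (simp add: weight_bounded_def)
qed

section \<open>Continuity in the price\<close>

text \<open>For a fixed policy the net value is affine in the price, with slope minus the resource
  measure. The uniform bound on the slope passes to the supremum.\<close>

lemma optimal_value_diff_le:
  assumes x: "x \<in> states P"
  shows "optimal_value P \<nu> x - optimal_value P \<mu> x \<le> \<bar>\<nu> - \<mu>\<bar> * (M * w x / (1 - \<gamma>))"
proof -
  have "net_value P \<nu> x \<pi> \<le> optimal_value P \<mu> x + \<bar>\<nu> - \<mu>\<bar> * (M * w x / (1 - \<gamma>))"
    if p: "\<pi> \<in> policies P" for \<pi>
  proof -
    have "net_value P \<mu> x \<pi>' \<le> horizon_value \<mu> 0 x + (1 + \<bar>\<mu>\<bar>) * M * w x * \<gamma> ^ 0 / (1 - \<gamma>)"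
      if "\<pi>' \<in> policies P" for \<pi>'
      by (rule controlled_project.net_value_upper[OF controlled_projectI[OF that x]])
    then have "net_value P \<mu> x \<pi> \<le> optimal_value P \<mu> x"
      unfolding optimal_value_def using p by (intro cSUP_upper bdd_aboveI2) auto
    moreover have "net_value P \<nu> x \<pi> - net_value P \<mu> x \<pi> = (\<mu> - \<nu>) * resource_measure P x \<pi>"
      by (simp add: net_value_def algebra_simps)
    moreover have "\<dots> \<le> \<bar>\<nu> - \<mu>\<bar> * \<bar>resource_measure P x \<pi>\<bar>"
      by (metis abs_ge_self abs_minus_commute abs_mult)
    moreover have "\<dots> \<le> \<bar>\<nu> - \<mu>\<bar> * (M * w x / (1 - \<gamma>))"
      using controlled_project.abs_resource_measure_le[OF controlled_projectI[OF p x]]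
      by (intro mult_left_mono) auto
    ultimately show ?thesis by linarith
  qed
  then have "optimal_value P \<nu> x \<le> optimal_value P \<mu> x + \<bar>\<nu> - \<mu>\<bar> * (M * w x / (1 - \<gamma>))"
    unfolding optimal_value_def[of P \<nu>] using greedy_policy by (intro cSUP_least) auto
  then show ?thesis by simp
qed

text \<open>The Lipschitz constant of the optimal value at \<open>y\<close> is a multiple of
  \<open>w y\<close>, so the discounted kernel step yields a finite Lipschitz constant at
  \<open>x\<close>.\<close>

lemma continuous_action_value:
  assumes x: "x \<in> states P"
  shows "continuous_on UNIV (\<lambda>\<nu>. action_value P \<nu> a x)"
proof -
  have "\<bar>action_value P \<nu> a x - action_value P \<mu> a x\<bar>
      \<le> (\<bar>consumption P x a\<bar> + M / (1 - \<gamma>) * \<gamma> * w x) * \<bar>\<nu> - \<mu>\<bar>" for \<nu> \<mu>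
  proof -
    have "\<bar>optimal_value P \<nu> y - optimal_value P \<mu> y\<bar> \<le> (\<bar>\<nu> - \<mu>\<bar> * (M / (1 - \<gamma>))) * w y"
      if "y \<in> states P" for y
      using optimal_value_diff_le[OF that, of \<nu> \<mu>] optimal_value_diff_le[OF that, of \<mu> \<nu>]
      by (simp add: abs_le_iff abs_minus_commute)
    from discounted_kernel_diff_le[OF weight_bounded_optimal_value weight_bounded_optimal_value x this]
    have "\<bar>\<beta> * (\<integral>y. optimal_value P \<nu> y \<partial>kernel P a x) - \<beta> * (\<integral>y. optimal_value P \<mu> y \<partial>kernel P a x)\<bar>
        \<le> (\<bar>\<nu> - \<mu>\<bar> * (M / (1 - \<gamma>))) * \<gamma> * w x"
      using M_nonneg \<gamma> by simp
    moreover have "\<bar>\<mu> * consumption P x a - \<nu> * consumption P x a\<bar> = \<bar>\<nu> - \<mu>\<bar> * \<bar>consumption P x a\<bar>"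
      by (simp add: left_diff_distrib[symmetric] abs_mult abs_minus_commute)
    ultimately have "\<bar>action_value P \<nu> a x - action_value P \<mu> a x\<bar>
        \<le> \<bar>\<nu> - \<mu>\<bar> * \<bar>consumption P x a\<bar> + (\<bar>\<nu> - \<mu>\<bar> * (M / (1 - \<gamma>))) * \<gamma> * w x"
      unfolding action_value_def by linarith
    then show ?thesis by (simp add: algebra_simps)
  qed
  then have "(\<bar>consumption P x a\<bar> + M / (1 - \<gamma>) * \<gamma> * w x)-lipschitz_on UNIV (\<lambda>\<nu>. action_value P \<nu> a x)"
    using M_nonneg \<gamma> \<gamma>_nonneg w_nonneg[OF x] by (intro lipschitz_onI) (auto simp: dist_real_def)
  then show ?thesis by (rule lipschitz_on_continuous_on)
qed

end

lemma continuous_marginal_value: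
  assumes P: "valid_project P" and x: "x \<in> states P"
  shows "continuous_on UNIV (\<lambda>\<nu>. marginal_value P \<nu> x)"
proof -
  from P obtain w M \<gamma> where "w \<in> borel_measurable (state_space P)"
    "\<forall>x\<in>states P. 1 \<le> w x" "disc P \<le> \<gamma>" "\<gamma> < 1"
    "\<forall>x\<in>states P. \<forall>a. max \<bar>reward P x a\<bar> (consumption P x a) \<le> M * w x"
    "\<forall>x\<in>states P. \<forall>a. ennreal (disc P) * (\<integral>\<^sup>+y. ennreal (w y) \<partial>kernel P a x) \<le> ennreal (\<gamma> * w x)"
    unfolding valid_project_def by blast
  with P interpret weighted_project P w M \<gamma>
    by unfold_locales auto
  show ?thesis
    unfolding marginal_value_def by (intro continuous_on_diff continuous_action_value x)
qed

section \<open>Threshold map and index\<close>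

text \<open>The intermediate value theorem, in the form that carries a sign known at one price to
  all prices on the same side of a zero.\<close>

lemma negative_of_continuous_nonzero:
  fixes f :: "real \<Rightarrow> real"
  assumes "continuous_on I f" "connected I" "\<And>t. t \<in> I \<Longrightarrow> f t \<noteq> 0" "a \<in> I" "b \<in> I" "f a < 0"
  shows "f b < 0"
proof (rule ccontr)
  assume "\<not> f b < 0"
  moreover have "connected (f ` I)" using assms by (intro connected_continuous_image)
  ultimately have "0 \<in> f ` I"
    using assms connectedD_interval[of "f ` I" "f a" "f b" 0] by simp
  then show False using assms(3) by force
qed

text \<open>Infinite thresholds are included, so later arguments compare \<open>z \<nu>\<close> with
  states by order alone.\<close>

lemma sgn_ereal_diff:
  "sgn (ereal x - y) = (if y < ereal x then 1 else if y = ereal x then 0 else -1)"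
  by (cases y) (auto simp: sgn_real_def zero_ereal_def one_ereal_def)

lemma strongly_thresholdable_iff:
  assumes "strongly_thresholdable P z" "x \<in> states P"
  shows "0 < marginal_value P \<nu> x \<longleftrightarrow> z \<nu> < ereal x"
    and "marginal_value P \<nu> x < 0 \<longleftrightarrow> ereal x < z \<nu>"
    and "marginal_value P \<nu> x = 0 \<longleftrightarrow> z \<nu> = ereal x"
proof -
  have "ereal (sgn (marginal_value P \<nu> x)) = sgn (ereal x - z \<nu>)"
    using assms by (simp add: strongly_thresholdable_def)
  then show "0 < marginal_value P \<nu> x \<longleftrightarrow> z \<nu> < ereal x"
    "marginal_value P \<nu> x < 0 \<longleftrightarrow> ereal x < z \<nu>"
    "marginal_value P \<nu> x = 0 \<longleftrightarrow> z \<nu> = ereal x"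
    by (auto simp: sgn_ereal_diff sgn_real_def zero_ereal_def one_ereal_def split: if_splits)
qed

lemma is_whittle_index_iff:
  assumes "is_whittle_index P \<iota>" "x \<in> states P"
  shows "0 < marginal_value P \<nu> x \<longleftrightarrow> \<nu> < \<iota> x"
    and "marginal_value P \<nu> x < 0 \<longleftrightarrow> \<iota> x < \<nu>"
    and "marginal_value P \<nu> x = 0 \<longleftrightarrow> \<nu> = \<iota> x"
proof -
  have "sgn (marginal_value P \<nu> x) = sgn (\<iota> x - \<nu>)"
    using assms by (simp add: is_whittle_index_def)
  then show "0 < marginal_value P \<nu> x \<longleftrightarrow> \<nu> < \<iota> x" "marginal_value P \<nu> x < 0 \<longleftrightarrow> \<iota> x < \<nu>"
    "marginal_value P \<nu> x = 0 \<longleftrightarrow> \<nu> = \<iota> x"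
    by (auto simp: sgn_if split: if_splits)
qed

locale thresholdable_project =
  fixes P :: project and z :: "real \<Rightarrow> ereal"
  assumes valid: "valid_project P" and threshold: "strongly_thresholdable P z"
begin

abbreviation "S \<equiv> state_prices P z"

lemmas threshold_iff = strongly_thresholdable_iff[OF threshold]

section \<open>From an index to the threshold map\<close>

context
  fixes \<iota> :: "real \<Rightarrow> real"
  assumes index: "is_whittle_index P \<iota>"
begin

text \<open>Both comparisons express the sign of the same marginal value. This exchange of prices
  for states drives the forward direction.\<close>

lemma index_iff:
  assumes "x \<in> states P"
  shows "z \<nu> < ereal x \<longleftrightarrow> \<nu> < \<iota> x"
    and "ereal x < z \<nu> \<longleftrightarrow> \<iota> x < \<nu>"
    and "z \<nu> = ereal x \<longleftrightarrow> \<nu> = \<iota> x"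
  using threshold_iff[OF assms] is_whittle_index_iff[OF index assms] by auto

lemma z_index: "x \<in> states P \<Longrightarrow> z (\<iota> x) = ereal x"
  using index_iff by simp

lemma state_pricesE:
  assumes "\<nu> \<in> S" obtains x where "x \<in> states P" "z \<nu> = ereal x" "\<nu> = \<iota> x"
  using assms index_iff(3) by (auto simp: state_prices_def)

lemma index_strict_mono: "strict_mono_on (states P) \<iota>"
proof (rule strict_mono_onI)
  fix x y assume "x \<in> states P" "y \<in> states P" "x < y"
  then show "\<iota> x < \<iota> y" using index_iff(2)[of x "\<iota> y"] z_index by simp
qed

text \<open>By \<open>index_iff\<close>, the states whose index lies above or below
  \<open>\<nu>\<close> form a ray cut off at \<open>z \<nu>\<close>, which is open relative to the
  state space.\<close>

lemma index_continuous: "continuous_on (states P) \<iota>"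
  unfolding continuous_on_def
proof (intro ballI order_tendstoI)
  fix x \<nu> assume x: "x \<in> states P"
  have lim: "(ereal \<longlongrightarrow> ereal x) (at x within states P)" by (intro tendsto_intros)
  have X: "\<forall>\<^sub>F y in at x within states P. y \<in> states P"
    by (simp add: eventually_at_filter)
  show "\<forall>\<^sub>F y in at x within states P. \<nu> < \<iota> y" if "\<nu> < \<iota> x"
    using order_tendstoD(1)[OF lim index_iff(1)[OF x, THEN iffD2, OF that]] X
    by eventually_elim (simp only: index_iff)
  show "\<forall>\<^sub>F y in at x within states P. \<iota> y < \<nu>" if "\<iota> x < \<nu>"
    using order_tendstoD(2)[OF lim index_iff(2)[OF x, THEN iffD2, OF that]] X
    by eventually_elim (simp only: index_iff)
qed

lemma threshold_strict_mono: "strict_mono_on S z"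
proof (rule strict_mono_onI)
  fix \<nu> \<mu> assume "\<nu> \<in> S" "\<mu> \<in> S" "\<nu> < \<mu>"
  then show "z \<nu> < z \<mu>" using index_iff(2) by (metis state_pricesE)
qed

lemma threshold_image: "z ` S = ereal ` states P"
  using z_index by (force simp: state_prices_def image_iff)

text \<open>An increasing map onto an interval has no jumps: a state \<open>r\<close> close to
  \<open>z \<nu>\<close> provides the price \<open>\<iota> r\<close> that delimits a neighbourhood
  of \<open>\<nu>\<close>.\<close>

lemma threshold_continuous: "continuous_on S z"
  unfolding continuous_on_def
proof (intro ballI order_tendstoI)
  fix \<nu> b assume "\<nu> \<in> S"
  then obtain x where x: "x \<in> states P" "z \<nu> = ereal x" "\<nu> = \<iota> x" by (rule state_pricesE)
  have S: "\<forall>\<^sub>F \<mu> in at \<nu> within S. \<mu> \<in> S" by (simp add: eventually_at_filter)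
  have id: "((\<lambda>\<mu>. \<mu>) \<longlongrightarrow> \<nu>) (at \<nu> within S)" by (rule tendsto_ident_at)
  have range: "lower P \<le> z \<mu>" "z \<mu> \<le> upper P" if "\<mu> \<in> S" for \<mu>
    using that by (auto simp: state_prices_def states_def)
  show "\<forall>\<^sub>F \<mu> in at \<nu> within S. b < z \<mu>" if b: "b < z \<nu>"
  proof -
    \<comment> \<open>The bound \<open>b\<close> may be infinite or lie outside the state space, so
      a real number between it and \<open>x\<close> replaces it.\<close>
    obtain r where r: "b < ereal r" "r < x" using b x ereal_dense2[of b "ereal x"] by auto
    show ?thesis
    proof (cases "r \<in> states P")
      case True
      then have less: "\<iota> r < \<nu>" using r x strict_mono_onD[OF index_strict_mono] by simp
      show ?thesis using order_tendstoD(1)[OF id less]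
        by eventually_elim (use True r index_iff(2) in \<open>auto intro: less_trans\<close>)
    next
      \<comment> \<open>Then \<open>r\<close> lies below the whole state space, and every threshold
        attained on \<open>S\<close> exceeds \<open>b\<close>.\<close>
      case False
      moreover have "ereal r \<le> upper P"
        using r x order_trans[of "ereal r" "ereal x" "upper P"] by (simp add: states_def less_imp_le)
      ultimately have "ereal r < lower P" by (simp add: states_def)
      with r(1) have "b < lower P" by (rule less_trans)
      show ?thesis using S by eventually_elim (rule less_le_trans[OF \<open>b < lower P\<close> range(1)])
    qed
  qed
  show "\<forall>\<^sub>F \<mu> in at \<nu> within S. z \<mu> < b" if b: "z \<nu> < b"
  proof -
    obtain r where r: "ereal r < b" "x < r" using b x ereal_dense2[of "ereal x" b] by auto
    show ?thesis
    proof (cases "r \<in> states P")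
      case True
      then have less: "\<nu> < \<iota> r" using r x strict_mono_onD[OF index_strict_mono] by simp
      show ?thesis using order_tendstoD(2)[OF id less]
        by eventually_elim (use True r index_iff(1) in \<open>auto intro: less_trans\<close>)
    next
      case False
      moreover have "lower P \<le> ereal r"
        using r x order_trans[of "lower P" "ereal x" "ereal r"] by (simp add: states_def less_imp_le)
      ultimately have "upper P < ereal r" by (simp add: states_def)
      then have "upper P < b" using r(1) by (rule less_trans)
      show ?thesis using S by eventually_elim (rule le_less_trans[OF range(2) \<open>upper P < b\<close>])
    qed
  qed
qed

text \<open>Strict monotonicity gives the injectivity that \<open>the_inv_into\<close> relies on,
  and \<open>\<iota> x\<close> is a preimage of \<open>x\<close> by \<open>z_index\<close>.\<close>

lemma index_eq_the_inv_into:
  assumes "x \<in> states P" shows "\<iota> x = the_inv_into S z (ereal x)"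
  using the_inv_into_f_eq[OF strict_mono_on_imp_inj_on[OF threshold_strict_mono] z_index[OF assms]] assms
  by (simp add: state_prices_def z_index)

end

section \<open>From the threshold map to an index\<close>

lemma indexable_if_strict_mono:
  assumes mono: "strict_mono_on S z" and image: "z ` S = ereal ` states P"
  shows "indexable P"
proof -
  have "\<forall>x\<in>states P. \<exists>\<nu>\<in>S. z \<nu> = ereal x" using image by (metis imageE imageI)
  then obtain \<iota> where \<iota>: "\<And>x. x \<in> states P \<Longrightarrow> \<iota> x \<in> S" "\<And>x. x \<in> states P \<Longrightarrow> z (\<iota> x) = ereal x"
    by metis
  \<comment> \<open>A price with threshold \<open>x\<close> belongs to \<open>S\<close>
    automatically, so injectivity on \<open>S\<close> makes the zero unique among all
    prices.\<close>
  have zero: "marginal_value P \<nu> x = 0 \<longleftrightarrow> \<nu> = \<iota> x" if "x \<in> states P" for x \<nu>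
    unfolding threshold_iff[OF that]
    using \<iota>[OF that] that strict_mono_on_imp_inj_on[OF mono] by (auto simp: state_prices_def inj_on_def)
  have \<iota>_less: "\<iota> x < \<iota> y" if "x \<in> states P" "y \<in> states P" "x < y" for x y
    using that strict_mono_on_less[OF mono \<iota>(1) \<iota>(1), of x y] \<iota>(2) by simp
  have cont: "continuous_on I (\<lambda>\<nu>. marginal_value P \<nu> x)" if "x \<in> states P" for x I
    using continuous_marginal_value[OF valid that] by (rule continuous_on_subset) simp
  have inner: "x \<in> states P" if "lower P < ereal x" "ereal x < upper P" for x
    using that by (simp add: states_def less_imp_le)
  \<comment> \<open>On the ray above \<open>\<iota> x\<close> there is no zero, and at its point
    \<open>\<iota> y\<close> the threshold \<open>y\<close> exceeds \<open>x\<close>, so the sign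
    there is negative.\<close>
  have neg': "marginal_value P \<nu> x < 0"
    if x: "x \<in> states P" and y: "y \<in> states P" "x < y" and \<nu>: "\<iota> x < \<nu>" for x y \<nu>
  proof (rule negative_of_continuous_nonzero[where f="\<lambda>\<nu>. marginal_value P \<nu> x" and b=\<nu> and I="{\<iota> x<..}" and a="\<iota> y"])
    show "marginal_value P (\<iota> y) x < 0" using threshold_iff[OF x] \<iota>(2)[OF y(1)] y by simp
  qed (use cont x y \<nu> zero \<iota>_less in auto)
  have pos': "0 < marginal_value P \<nu> x"
    if x: "x \<in> states P" and y: "y \<in> states P" "y < x" and \<nu>: "\<nu> < \<iota> x" for x y \<nu>
  proof -
    \<comment> \<open>Negating the function lets the same sign lemma serve the ray below
      \<open>\<iota> x\<close>.\<close>
    have "- marginal_value P \<nu> x < 0"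
    proof (rule negative_of_continuous_nonzero[where f="\<lambda>\<nu>. - marginal_value P \<nu> x" and b=\<nu> and I="{..<\<iota> x}" and a="\<iota> y"])
      show "- marginal_value P (\<iota> y) x < 0" using threshold_iff[OF x] \<iota>(2)[OF y(1)] y by simp
    qed (use cont x y \<nu> zero \<iota>_less in \<open>auto intro: continuous_on_minus\<close>)
    then show ?thesis by simp
  qed
  have neg: "marginal_value P \<nu> x < 0" if x: "x \<in> states P" and \<nu>: "\<iota> x < \<nu>" for x \<nu>
  proof (cases "\<exists>y\<in>states P. x < y")
    case True
    then show ?thesis using neg' x \<nu> by blast
  next
    \<comment> \<open>Now \<open>x\<close> is the largest state and no \<open>\<iota> y\<close> lies
      above \<open>\<iota> x\<close>. A wrong sign would put \<open>z \<nu>\<close> below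
      \<open>x\<close>; a state \<open>r\<close> strictly between them would have to be active by
      its threshold, yet \<open>neg'\<close> compares \<open>r\<close> with \<open>x\<close> and
      makes it passive.\<close>
    case False
    \<comment> \<open>As the state space is nondegenerate, its largest state cannot be the lower
      endpoint, so smaller states approach it.\<close>
    have "lower P < ereal x"
    proof (rule ccontr)
      assume "\<not> lower P < ereal x"
      then have "ereal x < upper P" using valid by (auto simp: valid_project_def)
      then obtain y where y: "ereal x < ereal y" "ereal y < upper P" using ereal_dense2 by blast
      have "lower P \<le> ereal x" using x by (simp add: states_def)
      from inner[OF le_less_trans[OF this y(1)] y(2)] show False using False y(1) by simp
    qed
    show ?thesis
    proof (rule ccontr)
      assume "\<not> marginal_value P \<nu> x < 0"
      then have "z \<nu> < ereal x"
        using zero[OF x, of \<nu>] \<nu> threshold_iff[OF x, of \<nu>] by (metis less_irrefl linorder_neqE)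
      \<comment> \<open>The maximum with \<open>lower P\<close> keeps \<open>r\<close> in the state
        space even if \<open>z \<nu>\<close> lies below it or is infinite.\<close>
      with \<open>lower P < ereal x\<close> obtain r where r: "max (z \<nu>) (lower P) < ereal r" "ereal r < ereal x"
        using ereal_dense2[of "max (z \<nu>) (lower P)" "ereal x"] by auto
      then have "r \<in> states P"
        using x less_le_trans[of "ereal r" "ereal x" "upper P"] by (intro inner) (auto simp: states_def)
      moreover from this have "marginal_value P \<nu> r < 0"
        using neg'[of r x \<nu>] x r \<nu> \<iota>_less[of r x] by simp
      ultimately show False using r threshold_iff(2)[of r \<nu>] by auto
    qed
  qed
  have pos: "0 < marginal_value P \<nu> x" if x: "x \<in> states P" and \<nu>: "\<nu> < \<iota> x" for x \<nu>
  proof (cases "\<exists>y\<in>states P. y < x")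
    case True
    then show ?thesis using pos' x \<nu> by blast
  next
    \<comment> \<open>The mirror image at the smallest state: a state \<open>r\<close> between
      \<open>x\<close> and \<open>z \<nu>\<close> would be passive by its threshold but active by
      \<open>pos'\<close>.\<close>
    case False
    have "ereal x < upper P"
    proof (rule ccontr)
      assume "\<not> ereal x < upper P"
      then have "lower P < ereal x" using valid by (auto simp: valid_project_def)
      then obtain y where y: "lower P < ereal y" "ereal y < ereal x" using ereal_dense2 by blast
      have "ereal x \<le> upper P" using x by (simp add: states_def)
      from inner[OF y(1) less_le_trans[OF y(2) this]] show False using False y(2) by simp
    qed
    show ?thesis
    proof (rule ccontr)
      assume "\<not> 0 < marginal_value P \<nu> x"
      then have "ereal x < z \<nu>"
        using zero[OF x, of \<nu>] \<nu> threshold_iff[OF x, of \<nu>] by (metis less_irrefl linorder_neqE)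
      with \<open>ereal x < upper P\<close> obtain r where r: "ereal x < ereal r" "ereal r < min (z \<nu>) (upper P)"
        using ereal_dense2[of "ereal x" "min (z \<nu>) (upper P)"] by auto
      then have "r \<in> states P"
        using x le_less_trans[of "lower P" "ereal x" "ereal r"] by (intro inner) (auto simp: states_def)
      moreover from this have "0 < marginal_value P \<nu> r"
        using pos'[of r x \<nu>] x r \<nu> \<iota>_less[of x r] by simp
      ultimately show False using r threshold_iff(1)[of r \<nu>] by auto
    qed
  qed
  have "is_whittle_index P \<iota>"
    unfolding is_whittle_index_def
  proof (intro ballI allI)
    fix x \<nu> assume x: "x \<in> states P"
    show "sgn (marginal_value P \<nu> x) = sgn (\<iota> x - \<nu>)"
      using zero[OF x, of \<nu>] pos[OF x, of \<nu>] neg[OF x, of \<nu>] by (cases \<nu> "\<iota> x" rule: linorder_cases) auto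
  qed
  then show ?thesis by (auto simp: indexable_def)
qed

end

text \<open>The image condition expresses that the inverse of \<open>z\<close> is defined at every
  state. Quantifying over all indices also shows that an index is determined on the states.\<close>

theorem proposition3:
  fixes P :: project and z :: "real \<Rightarrow> ereal"
  assumes "valid_project P"
    and "strongly_thresholdable P z"
  shows "(indexable P \<longleftrightarrow>
            strict_mono_on (state_prices P z) z \<and>
            continuous_on (state_prices P z) z \<and>
            z ` state_prices P z = ereal ` states P) \<and>
         (\<forall>\<iota>. is_whittle_index P \<iota> \<longrightarrow>
            strict_mono_on (states P) \<iota> \<and>
            continuous_on (states P) \<iota> \<and>
            (\<forall>x\<in>states P. \<iota> x = the_inv_into (state_prices P z) z (ereal x)))"
proof -
  interpret thresholdable_project P z using assms by unfold_locales
  show ?thesis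
    using indexable_if_strict_mono threshold_strict_mono threshold_continuous threshold_image
      index_strict_mono index_continuous index_eq_the_inv_into
    unfolding indexable_def by blast
qed

end
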